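(* For every integer $n\ge 0$, $$\mathrm{SEDO}(5n)\equiv 0 \pmod 5,$$ $$\mathrm{SEDO}(7n)\equiv 0 \pmod 7.$$
   Context: A partition of $n$ without repeated odd parts is a partition of $n$ in which each odd part occurs at most once (even parts may be repeated without restriction). $\mathrm{SEDO}(n)$ denotes the sum of all the even parts (counted with multiplicity) in all the partitions of $n$ without repeated odd parts. *)

theory Defs
  imports "HOL-Library.Multiset" "HOL-Number_Theory.Cong"
begin

(* A partition of n is the multiset of its parts. *)
definition partitions :: "nat \<Rightarrow> nat multiset set" where
  "partitions n = {P. (\<forall>p\<in>#P. p > 0) \<and> sum_mset P = n}"

definition no_repeated_odd_parts :: "nat multiset \<Rightarrow> bool" where
  "no_repeated_odd_parts P \<longleftrightarrow> (\<forall>p. odd p \<longrightarrow> count P p \<le> 1)"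

(* The inner sum_mset counts each even part with its multiplicity. The outer sum is over
   a finite set (finite_partitions below), so it is a genuine sum. *)
definition SEDO :: "nat \<Rightarrow> nat" where
  "SEDO n = (\<Sum>P | P \<in> partitions n \<and> no_repeated_odd_parts P. sum_mset (filter_mset even P))"

lemma finite_partitions: "finite (partitions n)"
proof -
  have "partitions n \<subseteq> mset ` {xs. set xs \<subseteq> {..n} \<and> length xs \<le> n}"
  proof
    fix P assume "P \<in> partitions n"
    then have pos: "\<forall>p\<in>#P. p > 0" and sm: "sum_mset P = n"
      by (auto simp: partitions_def)
    obtain xs where xs: "P = mset xs" by (metis ex_mset)
    have sl: "sum_list xs = n" using sm xs by (simp add: sum_mset_sum_list)
    have "set xs \<subseteq> {..n}" using sl member_le_sum_list by fastforce
    moreover have "\<forall>p\<in>set xs. p > 0 \<Longrightarrow> length xs \<le> sum_list xs"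
      by (induction xs) auto
    ultimately show "P \<in> mset ` {xs. set xs \<subseteq> {..n} \<and> length xs \<le> n}"
      using pos sl xs by auto
  qed
  then show ?thesis
    by (rule finite_subset) (simp add: finite_lists_length_le)
qed

end

theory Submission
  imports Defs "HOL-Computational_Algebra.Formal_Power_Series" "HOL-Computational_Algebra.Polynomial"
begin

unbundle fps_syntax

text \<open>
  Split a partition without repeated odd parts into its set of odd parts and its multiset of even
  parts. With \<open>D = X d/dX\<close>, the generating function of SEDO is the product of
  \<open>(1 + X)(1 + X^3)(1 + X^5) \<cdots>\<close> with \<open>D\<close> of the series that counts partitions into even
  parts. Replacing \<open>X\<close> by \<open>- X\<close> changes the coefficient of \<open>X^n\<close> by \<open>(-1)^n\<close> only, and
  turns the series into \<open>G = - E1 D(E2) / E2^3\<close>, where \<open>Es = euler_product s\<close> is the product of \<open>1 - X^(s i)\<close>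
  over \<open>i \<ge> 1\<close> (\<open>SEDO_series_nth\<close>, \<open>SEDO_series_mult\<close>).

  The \<open>p\<close>-th power of an integral power series is a series in \<open>X^p\<close> modulo \<open>p\<close>, so multiplying
  \<open>G\<close> by the \<open>p\<close>-th power of a series with constant term 1 does not affect whether \<open>p\<close> divides
  all coefficients at multiples of \<open>p\<close> (\<open>prime_dvd_nth_multiples_cancel\<close>). The multiplier is
  chosen so that theta series appear.

  For \<open>p = 5\<close> one has \<open>6 E2^5 G = - E1 D(2 E2^3)\<close>. Euler's pentagonal number theorem for \<open>E1\<close>
  and Jacobi's formula for \<open>2 E2^3\<close> make this a double sum over \<open>(m, j)\<close> with exponent
  \<open>m(3m-1)/2 + j(j-1)\<close>. After completing squares, an exponent divisible by 5 means
  \<open>(6m-1)^2 + 6(2j-1)^2 \<equiv> 7\<close>, so both squares are 1 modulo 5. Then \<open>5\<close> divides \<open>j(j-1)\<close>,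
  which is the factor that \<open>D\<close> produces.

  For \<open>p = 7\<close> let \<open>U = 2 E1^3\<close> and let \<open>W\<close> be the sum of \<open>(1-6m) X^(m(3m-1)/2)\<close> over all
  integers \<open>m\<close>. The derivative form \<open>W E2^2 = E1^5\<close> of the quintuple product identity gives
  \<open>12 E1^7 G = 3 U D(W) - 5 W D(U)\<close>. In these double sums an exponent divisible by 7 forces
  either \<open>7\<close> to divide the weight \<open>2j-1\<close> of \<open>U\<close>, or both exponents to be divisible by 7, in
  which case the factor produced by \<open>D\<close> vanishes modulo 7.

  All theta series come from the Jacobi triple product, obtained from its finite form with
  Gaussian binomial coefficients. The identity for \<open>W\<close> follows from three of its special cases by
  rearranging a double sum over a lattice.
\<close>

section \<open>Formal sums over arbitrary index sets\<close>

text \<open>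
  The series \<open>\<Sum>i\<in>I. a i * X ^ e i\<close> with the index set kept explicit, so that products become
  sums over pairs and identities become bijections of index sets. It is meaningful when every
  exponent is attained only finitely often.
\<close>
definition formal_sum :: "'i set \<Rightarrow> ('i \<Rightarrow> int) \<Rightarrow> ('i \<Rightarrow> nat) \<Rightarrow> int fps" where
  "formal_sum I a e = Abs_fps (\<lambda>n. \<Sum>i | i \<in> I \<and> e i = n. a i)"

definition finite_fibres :: "'i set \<Rightarrow> ('i \<Rightarrow> nat) \<Rightarrow> bool" where
  "finite_fibres I e \<longleftrightarrow> (\<forall>n. finite {i \<in> I. e i = n})"

lemma formal_sum_nth: "formal_sum I a e $ n = (\<Sum>i | i \<in> I \<and> e i = n. a i)"
  by (simp add: formal_sum_def)

lemma finite_fibres_subset: "finite_fibres I e \<Longrightarrow> J \<subseteq> I \<Longrightarrow> finite_fibres J e"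
  unfolding finite_fibres_def
  by (intro allI, rule finite_subset [of _ "{i \<in> I. e i = n}" for n]) auto

lemma finite_fibres_Times:
  assumes "finite_fibres I e" "finite_fibres J f"
  shows "finite_fibres (I \<times> J) (\<lambda>(i, j). e i + f j)"
  unfolding finite_fibres_def
proof
  fix n
  have "{p \<in> I \<times> J. (case p of (i, j) \<Rightarrow> e i + f j) = n} \<subseteq>
      (\<Union>k\<le>n. {i \<in> I. e i = k}) \<times> (\<Union>k\<le>n. {j \<in> J. f j = k})"
    by auto
  then show "finite {p \<in> I \<times> J. (case p of (i, j) \<Rightarrow> e i + f j) = n}"
    by (rule finite_subset) (use assms in \<open>auto simp: finite_fibres_def\<close>)
qed

lemma formal_sum_mult:
  assumes I: "finite_fibres I e" and J: "finite_fibres J f"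
  shows "formal_sum I a e * formal_sum J b f =
    formal_sum (I \<times> J) (\<lambda>(i, j). a i * b j) (\<lambda>(i, j). e i + f j)"
proof (rule fps_ext)
  fix n
  let ?S = "\<lambda>k. {i \<in> I. e i = k} \<times> {j \<in> J. f j = n - k}"
  have "(formal_sum I a e * formal_sum J b f) $ n = (\<Sum>k\<le>n. \<Sum>(i, j)\<in>?S k. a i * b j)"
    by (simp add: fps_mult_nth formal_sum_nth sum_product sum.cartesian_product atLeast0AtMost)
  also have "\<dots> = (\<Sum>(i, j)\<in>(\<Union>k\<le>n. ?S k). a i * b j)"
    by (rule sum.UNION_disjoint [symmetric])
      (use I J in \<open>auto simp: finite_fibres_def\<close>)
  also have "(\<Union>k\<le>n. ?S k) = {p \<in> I \<times> J. (case p of (i, j) \<Rightarrow> e i + f j) = n}"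
    by auto
  finally show "(formal_sum I a e * formal_sum J b f) $ n =
      formal_sum (I \<times> J) (\<lambda>(i, j). a i * b j) (\<lambda>(i, j). e i + f j) $ n"
    by (simp add: formal_sum_nth)
qed

lemma formal_sum_bij_betw:
  assumes h: "bij_betw h I J"
    and "\<And>i. i \<in> I \<Longrightarrow> a i = b (h i)" "\<And>i. i \<in> I \<Longrightarrow> e i = f (h i)"
  shows "formal_sum I a e = formal_sum J b f"
proof (rule fps_ext)
  fix n
  have "bij_betw h {i \<in> I. e i = n} {j \<in> J. f j = n}"
    using h assms(3) by (auto simp: bij_betw_def inj_on_def)
  then have "(\<Sum>j | j \<in> J \<and> f j = n. b j) = (\<Sum>i | i \<in> I \<and> e i = n. b (h i))"
    by (rule sum.reindex_bij_betw [symmetric])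
  also have "\<dots> = (\<Sum>i | i \<in> I \<and> e i = n. a i)"
    by (rule sum.cong) (use assms(2) in auto)
  finally show "formal_sum I a e $ n = formal_sum J b f $ n"
    by (simp add: formal_sum_nth)
qed

lemma formal_sum_Un:
  assumes "finite_fibres I e" "finite_fibres J e" "I \<inter> J = {}"
  shows "formal_sum (I \<union> J) a e = formal_sum I a e + formal_sum J a e"
proof (rule fps_ext)
  fix n
  have "{i \<in> I \<union> J. e i = n} = {i \<in> I. e i = n} \<union> {i \<in> J. e i = n}"
    by auto
  then show "formal_sum (I \<union> J) a e $ n = (formal_sum I a e + formal_sum J a e) $ n"
    unfolding formal_sum_nth fps_add_nth
    using assms by (auto simp: finite_fibres_def intro!: sum.union_disjoint)
qed

lemma formal_sum_add: "formal_sum I (\<lambda>i. a i + b i) e = formal_sum I a e + formal_sum I b e"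
  by (rule fps_ext) (simp add: formal_sum_nth sum.distrib)

lemma sum_sign_reversing_involution:
  fixes a :: "'i \<Rightarrow> int"
  assumes "\<And>i. i \<in> A \<Longrightarrow> h i \<in> A" "\<And>i. i \<in> A \<Longrightarrow> h (h i) = i" "\<And>i. i \<in> A \<Longrightarrow> a (h i) = - a i"
  shows "sum a A = 0"
proof -
  have "sum a A = (\<Sum>i\<in>A. - a i)"
    by (rule sum.reindex_bij_witness [where i = h and j = h]) (use assms in auto)
  then show ?thesis by (simp add: sum_negf)
qed

lemma formal_sum_sign_reversing_involution:
  assumes "\<And>i. i \<in> I \<Longrightarrow> h i \<in> I" "\<And>i. i \<in> I \<Longrightarrow> h (h i) = i"
    "\<And>i. i \<in> I \<Longrightarrow> a (h i) = - a i" "\<And>i. i \<in> I \<Longrightarrow> e (h i) = e i"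
  shows "formal_sum I a e = 0"
  by (rule fps_ext, unfold formal_sum_nth fps_zero_nth,
      rule sum_sign_reversing_involution [where h = h]) (use assms in auto)

section \<open>Coefficients of prime powers of power series\<close>

definition euler_deriv :: "int fps \<Rightarrow> int fps" where
  "euler_deriv f = fps_X * fps_deriv f"

lemma euler_deriv_nth: "euler_deriv f $ n = int n * f $ n"
  by (cases n) (simp_all add: euler_deriv_def)

lemma euler_deriv_mult: "euler_deriv (f * g) = f * euler_deriv g + euler_deriv f * g"
  by (simp add: euler_deriv_def algebra_simps)

lemma euler_deriv_power: "euler_deriv (f ^ n) = of_nat n * f ^ (n - 1) * euler_deriv f"
  by (simp add: euler_deriv_def fps_deriv_power mult_ac fps_of_nat)

lemma euler_deriv_one: "euler_deriv 1 = 0"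
  by (simp add: euler_deriv_def)

lemma euler_deriv_double: "euler_deriv (2 * f) = 2 * euler_deriv f"
  by (simp add: euler_deriv_def mult_2 algebra_simps)

lemma euler_deriv_formal_sum:
  "euler_deriv (formal_sum I a e) = formal_sum I (\<lambda>i. int (e i) * a i) e"
  by (rule fps_ext) (simp add: euler_deriv_nth formal_sum_nth sum_distrib_left)

text \<open>
  Because \<open>D(f^p) = p f^(p-1) D f\<close>, the number \<open>k\<close> times the \<open>k\<close>-th coefficient of \<open>f^p\<close> is
  divisible by \<open>p\<close>.
\<close>
lemma prime_dvd_nth_prime_power:
  fixes f :: "int fps"
  assumes "prime p" "\<not> p dvd k"
  shows "int p dvd (f ^ p) $ k"
proof -
  have "int k * (f ^ p) $ k = euler_deriv (f ^ p) $ k"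
    by (simp add: euler_deriv_nth)
  also have "\<dots> = int p * (f ^ (p - 1) * euler_deriv f) $ k"
    by (simp add: euler_deriv_power mult.assoc fps_mult_of_nat_nth)
  finally have "int p dvd int k * (f ^ p) $ k" by simp
  moreover have "\<not> int p dvd int k" using assms by simp
  ultimately show ?thesis
    using assms(1) by (metis prime_dvd_mult_iff prime_nat_int_transfer)
qed

text \<open>
  Modulo \<open>p\<close> the coefficient of \<open>f^p g\<close> at a multiple of \<open>p\<close> involves only coefficients of \<open>g\<close> at
  multiples of \<open>p\<close>, so induction on the exponent recovers \<open>g\<close> from the product.
\<close>
lemma prime_dvd_nth_multiples_cancel:
  fixes f g :: "int fps"
  assumes p: "prime p" and f: "f $ 0 = 1"
    and fg: "\<And>n. int p dvd (f ^ p * g) $ (p * n)"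
  shows "int p dvd g $ (p * n)"
proof (induction n rule: less_induct)
  case (less n)
  have "(f ^ p * g) $ (p * n) = g $ (p * n) + (\<Sum>k\<in>{0<..p * n}. (f ^ p) $ k * g $ (p * n - k))"
    by (simp add: fps_mult_nth sum.head f fps_nth_power_0)
  moreover have "int p dvd (f ^ p) $ k * g $ (p * n - k)" if "k \<in> {0<..p * n}" for k
  proof (cases "p dvd k")
    case True
    then obtain l where k: "k = p * l" by blast
    then have "l \<le> n" "0 < l" using that p by (auto dest: prime_gt_0_nat)
    then have "int p dvd g $ (p * (n - l))" by (intro less) auto
    then show ?thesis by (simp add: k diff_mult_distrib2)
  qed (use p prime_dvd_nth_prime_power in auto)
  then have "int p dvd (\<Sum>k\<in>{0<..p * n}. (f ^ p) $ k * g $ (p * n - k))"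
    by (rule dvd_sum)
  ultimately show ?case using fg [of n] by (simp add: dvd_add_left_iff)
qed

lemma dvd_formal_sum_nth:
  assumes "\<And>i. i \<in> I \<Longrightarrow> e i = n \<Longrightarrow> d dvd a i"
  shows "d dvd formal_sum I a e $ n"
  unfolding formal_sum_nth using assms by (auto intro: dvd_sum)

lemma fps_X_power_dvd_iff: "fps_X ^ n dvd (f :: int fps) \<longleftrightarrow> (\<forall>k<n. f $ k = 0)"
proof
  assume "\<forall>k<n. f $ k = 0"
  then have "f = fps_X ^ n * Abs_fps (\<lambda>k. f $ (k + n))"
    by (intro fps_ext) (simp add: fps_X_power_mult_nth)
  then show "fps_X ^ n dvd f" by (rule dvdI)
qed (auto simp: fps_X_power_mult_nth dvd_def)

section \<open>Infinite products and the generating function of SEDO\<close>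

text \<open>
  The possibly infinite product of \<open>1 - X^t\<close> over \<open>t \<in> S\<close>, in expanded form: choosing the term
  \<open>- X^t\<close> from finitely many factors amounts to choosing a finite subset of \<open>S\<close>, so
  infinite products are formal sums, too.
\<close>
definition qprod :: "nat set \<Rightarrow> int fps" where
  "qprod S = formal_sum {T. finite T \<and> T \<subseteq> S} (\<lambda>T. (-1) ^ card T) (\<lambda>T. \<Sum>T)"

definition partition_series :: "nat set \<Rightarrow> int fps" where
  "partition_series S = formal_sum {M. set_mset M \<subseteq> S} (\<lambda>_. 1) sum_mset"

lemma finite_fibres_finite_subsets:
  assumes "0 \<notin> S"
  shows "finite_fibres {T. finite T \<and> T \<subseteq> S} (\<lambda>T. \<Sum>T)"
  unfolding finite_fibres_def
proof
  fix n
  have "{T \<in> {T. finite T \<and> T \<subseteq> S}. \<Sum>T = n} \<subseteq> Pow {..n}"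
    by (auto intro: member_le_sum [where f = "\<lambda>x::nat. x"])
  then show "finite {T \<in> {T. finite T \<and> T \<subseteq> S}. \<Sum>T = n}"
    by (rule finite_subset) simp
qed

lemma finite_fibres_msets:
  assumes "0 \<notin> S"
  shows "finite_fibres {M. set_mset M \<subseteq> S} sum_mset"
  unfolding finite_fibres_def
proof
  fix n
  have "{M \<in> {M. set_mset M \<subseteq> S}. sum_mset M = n} \<subseteq> partitions n"
    using assms by (auto simp: partitions_def intro!: gr0I)
  then show "finite {M \<in> {M. set_mset M \<subseteq> S}. sum_mset M = n}"
    by (rule finite_subset) (rule finite_partitions)
qed

lemma qprod_Un:
  assumes "0 \<notin> S" "0 \<notin> S'" "S \<inter> S' = {}"
  shows "qprod (S \<union> S') = qprod S * qprod S'"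
proof -
  let ?F = "\<lambda>S. {T. finite T \<and> T \<subseteq> S}"
  have bij: "bij_betw (\<lambda>(T, T'). T \<union> T') (?F S \<times> ?F S') (?F (S \<union> S'))"
    by (rule bij_betw_byWitness [where f' = "\<lambda>T. (T \<inter> S, T \<inter> S')"]) (use assms(3) in auto)
  have disj: "T \<inter> T' = {}" if "T \<subseteq> S" "T' \<subseteq> S'" for T T'
    using that assms(3) by blast
  have "qprod S * qprod S' = formal_sum (?F S \<times> ?F S')
      (\<lambda>(T, T'). (-1) ^ card T * (-1) ^ card T') (\<lambda>(T, T'). \<Sum>T + \<Sum>T')"
    unfolding qprod_def using assms(1,2) by (intro formal_sum_mult finite_fibres_finite_subsets)
  also have "\<dots> = qprod (S \<union> S')"
    unfolding qprod_def
    by (rule formal_sum_bij_betw [OF bij])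
      (auto simp: disj card_Un_disjoint sum.union_disjoint power_add)
  finally show ?thesis ..
qed

lemma qprod_empty: "qprod {} = 1"
proof (rule fps_ext)
  fix n :: nat
  have "{T. (finite T \<and> T \<subseteq> {}) \<and> \<Sum>T = n} = (if n = 0 then {{}} else {})"
    by auto
  then show "qprod {} $ n = 1 $ n"
    by (simp add: qprod_def formal_sum_nth)
qed

lemma qprod_singleton:
  assumes "t > 0"
  shows "qprod {t} = 1 - fps_X ^ t"
proof (rule fps_ext)
  fix n
  have "{T. (finite T \<and> T \<subseteq> {t}) \<and> \<Sum>T = n} = (if n = 0 then {{}} else if n = t then {{t}} else {})"
    using assms by (auto simp: subset_singleton_iff)
  then show "qprod {t} $ n = (1 - fps_X ^ t) $ n"
    using assms by (simp add: qprod_def formal_sum_nth)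
qed

lemma qprod_finite:
  assumes "finite S" "0 \<notin> S"
  shows "qprod S = (\<Prod>t\<in>S. 1 - fps_X ^ t)"
  using assms
proof (induction S rule: finite_induct)
  case (insert t S)
  then show ?case
    using qprod_Un [of "{t}" S] by (simp add: qprod_singleton)
qed (simp add: qprod_empty)

text \<open>
  The factors with \<open>t \<ge> n\<close> multiply to 1 up to terms of order \<open>n\<close>. This reduces identities for
  infinite products to finite ones, one coefficient at a time.
\<close>
lemma qprod_truncate:
  assumes "0 \<notin> S"
  shows "fps_X ^ n dvd qprod S - (\<Prod>t | t \<in> S \<and> t < n. 1 - fps_X ^ t)"
proof -
  let ?L = "{t. t \<in> S \<and> t < n}" and ?H = "{t. t \<in> S \<and> n \<le> t}"
  have "?L \<union> ?H = S" by auto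
  then have "qprod S = qprod ?L * qprod ?H"
    using assms qprod_Un [of ?L ?H] by fastforce
  also have "qprod ?L = (\<Prod>t\<in>?L. 1 - fps_X ^ t)"
    using assms by (intro qprod_finite) auto
  finally have "qprod S - (\<Prod>t\<in>?L. 1 - fps_X ^ t) = (\<Prod>t\<in>?L. 1 - fps_X ^ t) * (qprod ?H - 1)"
    by (simp add: algebra_simps)
  moreover have "fps_X ^ n dvd qprod ?H - 1"
    unfolding fps_X_power_dvd_iff
  proof (intro allI impI)
    fix k assume "k < n"
    have *: "T = {}" if "finite T" "T \<subseteq> ?H" "\<Sum>T = k" for T
    proof (rule ccontr)
      assume "T \<noteq> {}"
      then obtain t where "t \<in> T" by blast
      then have "n \<le> t" "t \<le> k"
        using that by (auto intro: member_le_sum [where f = "\<lambda>x::nat. x"])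
      with \<open>k < n\<close> show False by simp
    qed
    have "(finite T \<and> T \<subseteq> ?H) \<and> \<Sum>T = k \<longleftrightarrow> k = 0 \<and> T = {}" for T
    proof (cases "T = {}")
      case False
      then show ?thesis using * by blast
    qed auto
    then show "(qprod ?H - 1) $ k = 0"
      by (simp add: qprod_def formal_sum_nth)
  qed
  ultimately show ?thesis by simp
qed

lemma qprod_nth_0:
  assumes "0 \<notin> S"
  shows "qprod S $ 0 = 1"
proof -
  have "{t. t \<in> S \<and> t < 1} = {}" using assms by (auto intro: gr0I)
  then have "fps_X ^ 1 dvd qprod S - 1"
    using qprod_truncate [OF assms, of 1] by (simp only: prod.empty)
  then show ?thesis
    unfolding fps_X_power_dvd_iff by simp
qed

lemma qprod_range_truncate:
  fixes f :: "nat \<Rightarrow> nat"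
  assumes f: "strict_mono f" "0 < f 0"
  shows "fps_X ^ f n dvd qprod (range f) - (\<Prod>i<n. 1 - fps_X ^ f i)"
proof -
  have "{t. t \<in> range f \<and> t < f n} = f ` {..<n}"
    using strict_mono_less [of f] f(1) by auto
  moreover have "inj_on f {..<n}"
    using f(1) by (simp add: strict_mono_on_imp_inj_on strict_mono_imp_inj_on inj_on_subset)
  ultimately have "(\<Prod>t | t \<in> range f \<and> t < f n. 1 - fps_X ^ t) = (\<Prod>i<n. 1 - fps_X ^ f i :: int fps)"
    by (simp add: prod.reindex)
  moreover have "0 \<notin> range f"
  proof
    assume "0 \<in> range f"
    then obtain i where "f i = 0" by auto
    with f(2) monoD [OF strict_mono_mono [OF f(1)] le0, of i] show False by simp
  qed
  ultimately show ?thesis using qprod_truncate [of "range f" "f n"] by simp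
qed

text \<open>
  The product is a signed count of pairs of a multiset and a finite set with elements in \<open>S\<close>.
  Moving the largest element that occurs from the set into the multiset, or one copy of it from
  the multiset into the set if the set lacks it, cancels all pairs but the empty one.
\<close>
lemma partition_series_mult_qprod:
  assumes "0 \<notin> S"
  shows "partition_series S * qprod S = 1"
proof (rule fps_ext)
  fix n
  let ?I = "{M. set_mset M \<subseteq> S} \<times> {T. finite T \<and> T \<subseteq> S}"
  let ?a = "\<lambda>(M :: nat multiset, T :: nat set). 1 * (-1 :: int) ^ card T"
  let ?e = "\<lambda>(M, T). sum_mset M + \<Sum>T"
  have eq: "(partition_series S * qprod S) $ n = sum ?a {p \<in> ?I. ?e p = n}"
    unfolding partition_series_def qprod_def
    by (subst formal_sum_mult)
      (use assms in \<open>auto simp: formal_sum_nth finite_fibres_msets finite_fibres_finite_subsets\<close>)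
  show "(partition_series S * qprod S) $ n = 1 $ n"
  proof (cases "n = 0")
    case True
    have "{p \<in> ?I. ?e p = 0} = {({#}, {})}"
    proof (intro equalityI subsetI)
      fix p assume p: "p \<in> {p \<in> ?I. ?e p = 0}"
      obtain M T where MT: "p = (M, T)" by fastforce
      have "x \<notin># M" for x
      proof
        assume "x \<in># M"
        then have "x = 0" "x \<in> S" using p MT by (auto dest!: multi_member_split)
        then show False using assms by simp
      qed
      moreover have "x \<notin> T" for x
      proof
        assume "x \<in> T"
        then have "x = 0" "x \<in> S" using p MT by auto
        then show False using assms by simp
      qed
      ultimately show "p \<in> {({#}, {})}" by (auto simp: MT intro!: multiset_eqI simp: not_in_iff)
    qed auto
    then show ?thesis using eq True by simp
  next
    case False
    define t where "t = (\<lambda>(M, T). Max (set_mset M \<union> T) :: nat)"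
    define h where "h = (\<lambda>(M, T). if t (M, T) \<in> T then (add_mset (t (M, T)) M, T - {t (M, T)})
      else (M - {#t (M, T)#}, insert (t (M, T)) T))"
    have mem: "t (M, T) \<in># M \<or> t (M, T) \<in> T" if "(M, T) \<in> {p \<in> ?I. ?e p = n}" for M T
    proof -
      have "set_mset M \<union> T \<noteq> {}" using that False by auto
      then have "Max (set_mset M \<union> T) \<in> set_mset M \<union> T" using that by (intro Max_in) auto
      then show ?thesis by (simp add: t_def)
    qed
    have props: "h p \<in> {p \<in> ?I. ?e p = n} \<and> h (h p) = p \<and> ?a (h p) = - ?a p"
      if p: "p \<in> {p \<in> ?I. ?e p = n}" for p
    proof -
      obtain M T where MT: "p = (M, T)" by fastforce
      define m where "m = t (M, T)"
      have fin: "finite T" "set_mset M \<subseteq> S" "T \<subseteq> S" "sum_mset M + \<Sum>T = n"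
        using p by (auto simp: MT)
      show ?thesis
      proof (cases "m \<in> T")
        case True
        have "set_mset (add_mset m M) \<union> (T - {m}) = set_mset M \<union> T"
          using True by auto
        then have t': "t (add_mset m M, T - {m}) = m"
          by (simp add: t_def m_def)
        have hp: "h p = (add_mset m M, T - {m})"
          using True by (simp add: h_def MT m_def)
        have hh: "h (h p) = p"
          unfolding hp by (simp add: h_def t') (simp add: MT True insert_absorb)
        have "\<Sum>T = m + \<Sum>(T - {m})" using True fin by (simp add: sum.remove)
        moreover have "(-1 :: int) ^ card T = - ((-1) ^ card (T - {m}))"
          using True fin(1) by (subst card.remove) auto
        ultimately show ?thesis
          using hh fin True unfolding hp by (auto simp: MT)
      next
        case nT: False
        then have M: "m \<in># M" using mem p by (auto simp: MT m_def)
        then obtain M' where M': "M = add_mset m M'" by (metis insert_DiffM)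
        have "set_mset M' \<union> insert m T = set_mset M \<union> T" by (auto simp: M')
        then have t': "t (M', insert m T) = m"
          by (simp add: t_def m_def)
        have "t (add_mset m M', T) = m" using m_def unfolding M' ..
        then have hp: "h p = (M', insert m T)"
          using nT by (simp add: h_def MT M')
        have hh: "h (h p) = p"
          unfolding hp by (simp add: h_def t') (simp add: MT M' nT)
        show ?thesis
          using hh fin nT unfolding hp by (auto simp: MT M')
      qed
    qed
    have "sum ?a {p \<in> ?I. ?e p = n} = 0"
      by (rule sum_sign_reversing_involution [where h = h]) (use props in blast)+
    then show ?thesis using False by (simp add: eq)
  qed
qed

text \<open>
  In the variable \<open>- X\<close>, the generating function of SEDO: the derivative weights a multiset of
  even parts by its sum, and the sign of a set of odd parts is the parity of its sum.
\<close>
definition SEDO_series :: "int fps" where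
  "SEDO_series = qprod {t. odd t} * euler_deriv (partition_series {t. even t \<and> 0 < t})"

lemma minus_one_power_sum_of_odds:
  assumes "finite T" "T \<subseteq> {t. odd t}"
  shows "(-1 :: int) ^ card T = (-1) ^ (\<Sum>T)"
  using assms by (induction T rule: finite_induct) (auto simp: power_add)

lemma even_sum_mset_of_evens:
  "set_mset M \<subseteq> {t. even t \<and> 0 < t} \<Longrightarrow> even (sum_mset M :: nat)"
  by (induction M) auto

lemma bij_betw_split_by_parity:
  "bij_betw (\<lambda>(T, M). mset_set T + M)
    {p \<in> {T. finite T \<and> T \<subseteq> {t. odd t}} \<times> {M. set_mset M \<subseteq> {t. even t \<and> 0 < t}}.
      (case p of (T, M) \<Rightarrow> \<Sum>T + sum_mset M) = n}
    {P. P \<in> partitions n \<and> no_repeated_odd_parts P}"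
  (is "bij_betw ?h ?A ?B")
proof (rule bij_betw_byWitness [where f' = "\<lambda>P. (set_mset (filter_mset odd P), filter_mset even P)"])
  have filt: "filter_mset odd (mset_set T + M) = mset_set T \<and> filter_mset even (mset_set T + M) = M"
    if "finite T" "T \<subseteq> {t. odd t}" "set_mset M \<subseteq> {t. even t \<and> 0 < t}" for T M
  proof -
    have "{x \<in> T. odd x} = T" "{x \<in> T. even x} = {}"
      using that by auto
    then have "filter_mset odd (mset_set T) = mset_set T" "filter_mset even (mset_set T) = {#}"
      using that(1) by (metis filter_mset_mset_set mset_set.empty)+
    moreover have "filter_mset odd M = {#}" "filter_mset even M = M"
      using that by (auto simp: filter_mset_eq_conv)
    ultimately show ?thesis by simp
  qed
  then show "\<forall>p\<in>?A. (set_mset (filter_mset odd (?h p)), filter_mset even (?h p)) = p"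
    by auto
  have odds: "mset_set (set_mset (filter_mset odd P)) = filter_mset odd P"
    if "no_repeated_odd_parts P" for P
  proof (rule multiset_eqI)
    fix x
    have "count P x \<le> 1" if "odd x"
      using \<open>no_repeated_odd_parts P\<close> that by (simp add: no_repeated_odd_parts_def)
    then show "count (mset_set (set_mset (filter_mset odd P))) x = count (filter_mset odd P) x"
      by (cases "x \<in># P"; cases "odd x") (auto simp: le_Suc_eq count_eq_zero_iff count_mset_set')
  qed
  have part: "filter_mset odd P + filter_mset even P = P" for P :: "nat multiset"
    using multiset_partition [of P odd] by simp
  show "\<forall>P\<in>?B. ?h (set_mset (filter_mset odd P), filter_mset even P) = P"
    using odds part by auto
  show "?h ` ?A \<subseteq> ?B"
  proof
    fix P assume "P \<in> ?h ` ?A"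
    then obtain T M where P: "P = mset_set T + M" and T: "finite T" "T \<subseteq> {t. odd t}"
      and M: "set_mset M \<subseteq> {t. even t \<and> 0 < t}" and n: "\<Sum>T + sum_mset M = n"
      by auto
    have "count M x = 0" if "odd x" for x
      using M that by (auto simp: count_eq_zero_iff)
    then have "no_repeated_odd_parts P"
      by (auto simp: no_repeated_odd_parts_def P count_mset_set')
    moreover have "P \<in> partitions n"
      using T M n by (auto simp: partitions_def P sum_unfold_sum_mset intro: gr0I)
    ultimately show "P \<in> ?B" by simp
  qed
  show "(\<lambda>P. (set_mset (filter_mset odd P), filter_mset even P)) ` ?B \<subseteq> ?A"
  proof
    fix p assume "p \<in> (\<lambda>P. (set_mset (filter_mset odd P), filter_mset even P)) ` ?B"
    then obtain P where p: "p = (set_mset (filter_mset odd P), filter_mset even P)"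
      and P: "P \<in> partitions n" "no_repeated_odd_parts P" by auto
    have "\<Sum>(set_mset (filter_mset odd P)) = sum_mset (filter_mset odd P)"
      using odds [OF P(2)] by (metis sum_unfold_sum_mset image_mset.identity id_apply multiset.map_id0)
    then have "\<Sum>(set_mset (filter_mset odd P)) + sum_mset (filter_mset even P) = sum_mset P"
      by (metis part sum_mset.union)
    then show "p \<in> ?A"
      using P by (auto simp: p partitions_def)
  qed
qed

lemma SEDO_series_nth: "SEDO_series $ n = (-1) ^ n * int (SEDO n)"
proof -
  let ?O = "{T. finite T \<and> T \<subseteq> {t. odd t}}" and ?E = "{M. set_mset M \<subseteq> {t. even t \<and> 0 < t}}"
  let ?A = "{p \<in> ?O \<times> ?E. (case p of (T, M) \<Rightarrow> \<Sum>T + sum_mset M) = n}"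
  have "SEDO_series = formal_sum (?O \<times> ?E)
      (\<lambda>(T, M). (-1) ^ card T * (int (sum_mset M) * 1)) (\<lambda>(T, M). \<Sum>T + sum_mset M)"
    unfolding SEDO_series_def qprod_def partition_series_def euler_deriv_formal_sum
    by (intro formal_sum_mult finite_fibres_finite_subsets finite_fibres_msets) auto
  then have "SEDO_series $ n = (\<Sum>(T, M)\<in>?A. (-1) ^ card T * (int (sum_mset M) * 1))"
    by (metis formal_sum_nth)
  also have "\<dots> = (\<Sum>p\<in>?A. (-1) ^ n *
      int (sum_mset (filter_mset even (case p of (T, M) \<Rightarrow> mset_set T + M))))"
  proof (rule sum.cong [OF refl])
    fix p assume "p \<in> ?A"
    then obtain T M where p: "p = (T, M)" and T: "finite T" "T \<subseteq> {t. odd t}"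
      and M: "set_mset M \<subseteq> {t. even t \<and> 0 < t}" and n: "\<Sum>T + sum_mset M = n" by auto
    have "{x \<in> T. even x} = {}" using T by auto
    then have "filter_mset even (mset_set T) = {#}"
      using T by (metis filter_mset_mset_set mset_set.empty)
    moreover have "filter_mset even M = M"
      using M by (auto simp: filter_mset_eq_conv)
    ultimately have "filter_mset even (mset_set T + M) = M"
      by (metis filter_union_mset add_0)
    moreover have "(-1 :: int) ^ card T = (-1) ^ n"
      using minus_one_power_sum_of_odds [OF T] even_sum_mset_of_evens [OF M]
      by (simp flip: n add: power_add)
    ultimately show "(case p of (T, M) \<Rightarrow> (-1) ^ card T * (int (sum_mset M) * 1)) =
        (-1) ^ n * int (sum_mset (filter_mset even (case p of (T, M) \<Rightarrow> mset_set T + M)))"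
      by (simp add: p)
  qed
  also have "\<dots> = (\<Sum>P | P \<in> partitions n \<and> no_repeated_odd_parts P.
      (-1) ^ n * int (sum_mset (filter_mset even P)))"
    by (rule sum.reindex_bij_betw [OF bij_betw_split_by_parity])
  finally show ?thesis
    by (simp add: SEDO_def sum_distrib_left)
qed

section \<open>Gaussian binomial coefficients and the finite triple product\<close>

definition qpochhammer :: "'a::comm_ring_1 \<Rightarrow> nat \<Rightarrow> 'a" where
  "qpochhammer q n = (\<Prod>i<n. 1 - q ^ Suc i)"

fun qbinomial :: "'a::comm_ring_1 \<Rightarrow> nat \<Rightarrow> nat \<Rightarrow> 'a" where
  "qbinomial q n 0 = 1"
| "qbinomial q 0 (Suc k) = 0"
| "qbinomial q (Suc n) (Suc k) = qbinomial q n k + q ^ Suc k * qbinomial q n (Suc k)"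

lemma qbinomial_eq_0: "n < k \<Longrightarrow> qbinomial q n k = 0"
  by (induction q n k rule: qbinomial.induct) auto

lemma qbinomial_0: "qbinomial q 0 k = (if k = 0 then 1 else 0)"
  by (cases k) auto

text \<open>
  The second Pascal rule, with the power of \<open>q\<close> on the other summand. The triple product is built
  up from both ends, and each end uses one of the two rules.
\<close>
lemma qbinomial_Suc_Suc':
  "k \<le> n \<Longrightarrow> qbinomial q (Suc n) (Suc k) = qbinomial q n (Suc k) + q ^ (n - k) * qbinomial q n k"
proof (induction n arbitrary: k)
  case (Suc n)
  show ?case
  proof (cases "k = Suc n")
    case True
    then show ?thesis by (simp add: qbinomial_eq_0)
  next
    case False
    then have k: "k \<le> n" using Suc.prems by simp
    note IH = Suc.IH [OF k]
    show ?thesis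
    proof (cases k)
      case 0
      have "qbinomial q (Suc (Suc n)) (Suc 0) = 1 + q * qbinomial q (Suc n) (Suc 0)" by simp
      also have "qbinomial q (Suc n) (Suc 0) = qbinomial q n (Suc 0) + q ^ n"
        using IH 0 by simp
      finally show ?thesis using 0 by (simp add: algebra_simps)
    next
      case (Suc l)
      have "qbinomial q (Suc (Suc n)) (Suc k) =
          qbinomial q (Suc n) k + q ^ Suc k * qbinomial q (Suc n) (Suc k)" by simp
      also have "qbinomial q (Suc n) (Suc k) = qbinomial q n (Suc k) + q ^ (n - k) * qbinomial q n k"
        by (rule IH)
      also have "qbinomial q (Suc n) k = qbinomial q n k + q ^ Suc (n - k) * qbinomial q n l"
        using Suc.IH [of l] k Suc by (simp add: Suc_diff_Suc)
      finally have "qbinomial q (Suc (Suc n)) (Suc k) = qbinomial q n k + q ^ Suc (n - k) * qbinomial q n l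
          + q ^ Suc k * (qbinomial q n (Suc k) + q ^ (n - k) * qbinomial q n k)" .
      moreover have "qbinomial q (Suc n) (Suc k) + q ^ (Suc n - k) * qbinomial q (Suc n) k =
          qbinomial q n k + q ^ Suc k * qbinomial q n (Suc k)
          + q ^ Suc (n - k) * (qbinomial q n l + q ^ k * qbinomial q n k)"
        using k Suc by (simp add: Suc_diff_le Suc_diff_Suc [symmetric, of l n])
      moreover have "q ^ Suc k * q ^ (n - k) = q ^ Suc (n - k) * q ^ k"
        by (simp add: mult_ac)
      ultimately show ?thesis by (simp add: algebra_simps)
    qed
  qed
qed simp

lemma qpochhammer_Suc: "qpochhammer q (Suc n) = qpochhammer q n * (1 - q ^ Suc n)"
  by (simp add: qpochhammer_def)

lemma qbinomial_qpochhammer: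
  "k \<le> n \<Longrightarrow> qbinomial q n k * qpochhammer q k * qpochhammer q (n - k) = qpochhammer q n"
proof (induction n arbitrary: k)
  case (Suc n)
  show ?case
  proof (cases k)
    case 0
    then show ?thesis by (simp add: qpochhammer_def)
  next
    case k: (Suc l)
    then have "l \<le> n" using Suc.prems by simp
    note A = Suc.IH [OF this]
    show ?thesis
    proof (cases "l = n")
      case True
      have "qpochhammer q 0 = 1" by (simp add: qpochhammer_def)
      then show ?thesis
        using A True by (simp add: k qbinomial_eq_0 qpochhammer_Suc flip: mult.assoc)
    next
      case False
      then have l: "Suc l \<le> n" using \<open>l \<le> n\<close> by simp
      note B = Suc.IH [OF l]
      have P: "qpochhammer q (n - l) = qpochhammer q (n - Suc l) * (1 - q ^ (n - l))"
        using l qpochhammer_Suc [of q "n - Suc l"] by (simp add: Suc_diff_Suc)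
      have "qbinomial q (Suc n) k * qpochhammer q k * qpochhammer q (Suc n - k) =
          (1 - q ^ Suc l) * (qbinomial q n l * qpochhammer q l * qpochhammer q (n - l))
          + q ^ Suc l * (1 - q ^ (n - l)) *
            (qbinomial q n (Suc l) * qpochhammer q (Suc l) * qpochhammer q (n - Suc l))"
        by (simp add: k P qpochhammer_Suc) (simp add: algebra_simps)
      also have "\<dots> = qpochhammer q n * (1 - q ^ Suc l * q ^ (n - l))"
        unfolding A B by (simp add: algebra_simps)
      also have "q ^ Suc l * q ^ (n - l) = q ^ Suc n"
        using l by (metis power_add add_Suc le_add_diff_inverse Suc_leD)
      finally show ?thesis by (simp only: qpochhammer_Suc)
    qed
  qed
qed (simp add: qpochhammer_def)

text \<open>
  The exponent of the \<open>j\<close>-th term of the triple product with base \<open>X^s\<close> at the point \<open>- X^a\<close>.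
  For \<open>a \<le> s\<close> the integer is nonnegative, so the conversion to a natural number is exact.
\<close>
definition jacobi_exponent :: "nat \<Rightarrow> nat \<Rightarrow> int \<Rightarrow> nat" where
  "jacobi_exponent s a j = nat (int s * (j * (j - 1) div 2) + int a * j)"

lemma half_pronic_bounds:
  fixes j :: int
  shows "0 \<le> j * (j - 1) div 2" "\<bar>j\<bar> - 1 \<le> j * (j - 1) div 2"
proof -
  have tri: "2 * (j * (j - 1) div 2) = j * (j - 1)"
    by (simp add: even_mult_iff)
  have "0 \<le> j * (j - 1)"
    by (cases "j \<ge> 1") (simp_all add: zero_le_mult_iff)
  then show "0 \<le> j * (j - 1) div 2" using tri by linarith
  show "\<bar>j\<bar> - 1 \<le> j * (j - 1) div 2"
  proof (cases "j \<ge> 0")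
    case True
    have "0 \<le> (j - 1) * (j - 2)"
      by (cases "j \<ge> 2") (auto intro: mult_nonneg_nonneg mult_nonpos_nonpos)
    then show ?thesis using True tri by (simp add: algebra_simps)
  next
    case False
    then have "0 \<le> (j + 1) * j"
      by (intro mult_nonpos_nonpos) auto
    then show ?thesis using False tri by (simp add: algebra_simps)
  qed
qed

text \<open>
  With \<open>t = j(j-1)/2\<close> the exponent is \<open>(s - a) t + a (t + j)\<close>, and \<open>t + j\<close> is the number
  \<open>t\<close> formed for \<open>- j\<close>. The linear lower bound makes the exponents have finite fibres and
  controls the error terms in the limit of the finite triple product.
\<close>
lemma jacobi_exponent_bounds:
  fixes j :: int
  assumes "a \<le> s"
  defines "e \<equiv> int s * (j * (j - 1) div 2) + int a * j"
  shows "0 \<le> e" "0 < s \<Longrightarrow> \<bar>j\<bar> - 1 \<le> e"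
proof -
  define t where "t = j * (j - 1) div 2"
  have "2 * (j * (j - 1) div 2) = j * (j - 1)" "2 * ((j + 1) * j div 2) = (j + 1) * j"
    by (simp_all add: even_mult_iff)
  then have t': "t + j = (- j) * ((- j) - 1) div 2"
    by (simp add: t_def algebra_simps)
  have e: "e = (int s - int a) * t + int a * (t + j)"
    by (simp add: e_def t_def algebra_simps)
  have b: "0 \<le> t" "\<bar>j\<bar> - 1 \<le> t" using half_pronic_bounds [of j] by (simp_all add: t_def)
  have b': "0 \<le> t + j" "\<bar>j\<bar> - 1 \<le> t + j"
    using half_pronic_bounds [of "- j"] by (simp_all only: t' abs_minus_cancel)
  show "0 \<le> e" using b b' assms(1) by (simp add: e)
  show "\<bar>j\<bar> - 1 \<le> e" if "0 < s"
  proof (cases "a = 0")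
    case True
    have "1 * t \<le> int s * t" using b that by (intro mult_right_mono) auto
    then show ?thesis using b True by (simp add: e)
  next
    case False
    have "1 * (t + j) \<le> int a * (t + j)" using b' False by (intro mult_right_mono) auto
    moreover have "0 \<le> (int s - int a) * t" using b assms(1) by simp
    ultimately show ?thesis using b' by (simp add: e)
  qed
qed

lemma int_jacobi_exponent:
  "a \<le> s \<Longrightarrow> int (jacobi_exponent s a j) = int s * (j * (j - 1) div 2) + int a * j"
  using jacobi_exponent_bounds [of a s j] by (simp add: jacobi_exponent_def)

lemma abs_le_jacobi_exponent:
  "a \<le> s \<Longrightarrow> 0 < s \<Longrightarrow> \<bar>j\<bar> \<le> int (jacobi_exponent s a j) + 1"
  using jacobi_exponent_bounds [of a s j] by (simp add: jacobi_exponent_def)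

lemma finite_fibres_jacobi_exponent:
  assumes "a \<le> s" "0 < s"
  shows "finite_fibres J (jacobi_exponent s a)"
  unfolding finite_fibres_def
proof
  fix n
  have "{j \<in> J. jacobi_exponent s a j = n} \<subseteq> {- int n - 1..int n + 1}"
  proof
    fix j assume "j \<in> {j \<in> J. jacobi_exponent s a j = n}"
    then show "j \<in> {- int n - 1..int n + 1}"
      using abs_le_jacobi_exponent [OF assms, of j] by auto
  qed
  then show "finite {j \<in> J. jacobi_exponent s a j = n}"
    by (rule finite_subset) simp
qed

abbreviation triangular :: "int \<Rightarrow> nat" where
  "triangular \<equiv> jacobi_exponent 1 0"

lemma triangular_step: "int (triangular (j + 1)) = int (triangular j) + j"
proof -
  have "2 * (j * (j - 1) div 2) = j * (j - 1)" "2 * ((j + 1) * j div 2) = (j + 1) * j"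
    by (simp_all add: even_mult_iff)
  then show ?thesis by (simp add: int_jacobi_exponent algebra_simps)
qed

lemma coeff_linear_mult_0: "coeff ([:a, b:] * p) 0 = a * coeff p 0"
  by simp

lemma coeff_linear_mult_Suc:
  "coeff ([:a, b:] * p) (Suc k) = a * coeff p (Suc k) + b * coeff p k"
  by simp

text \<open>
  The finite triple product multiplied by \<open>z^n\<close>, which clears the negative powers of \<open>z\<close> and
  leaves a polynomial identity over any commutative ring. Keeping it polynomial also allows to
  differentiate in \<open>z\<close>, which Jacobi's formula for the cube needs.
\<close>
lemma finite_jacobi_triple_product:
  fixes q :: "'a::comm_ring_1"
  shows "coeff ((\<Prod>i<m. [:1, q ^ i:]) * (\<Prod>i<n. [:q ^ Suc i, 1:])) k =
    qbinomial q (m + n) k * q ^ triangular (int k - int n)"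
proof (induction m arbitrary: k)
  case 0
  show ?case
  proof (induction n arbitrary: k)
    case 0
    then show ?case by (simp add: qbinomial_0 jacobi_exponent_def coeff_1)
  next
    case (Suc n)
    let ?P = "(\<Prod>i<n. [:q ^ Suc i, 1:])"
    have IH: "coeff ?P k = qbinomial q n k * q ^ triangular (int k - int n)" for k
      using Suc.IH [of k] by simp
    have "coeff ([:q ^ Suc n, 1:] * ?P) k =
        qbinomial q (Suc n) k * q ^ triangular (int k - int (Suc n))"
    proof (cases k)
      case 0
      have "triangular (int 0 - int (Suc n)) = Suc n + triangular (int 0 - int n)"
        using triangular_step [of "- 1 - int n"] by simp
      then show ?thesis
        unfolding 0 coeff_linear_mult_0 IH by (simp only: qbinomial.simps power_add mult_1_left mult_1_right)
    next
      case (Suc l)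
      have "Suc n + triangular (int l + 1 - int n) = Suc l + triangular (int l - int n)"
        using triangular_step [of "int l - int n"] by (simp add: algebra_simps)
      then have "q ^ Suc n * q ^ triangular (int l + 1 - int n) =
          q ^ Suc l * q ^ triangular (int l - int n)"
        by (metis power_add)
      then have "q ^ Suc n * (qbinomial q n (Suc l) * q ^ triangular (int l + 1 - int n)) =
          q ^ Suc l * qbinomial q n (Suc l) * q ^ triangular (int l - int n)"
        by (simp only: mult.assoc mult.left_commute [of _ "qbinomial q n (Suc l)"])
      then show ?thesis
        unfolding Suc coeff_linear_mult_Suc IH by (simp add: algebra_simps)
    qed
    then show ?case by (simp add: mult_ac)
  qed
next
  case (Suc m)
  let ?P = "(\<Prod>i<m. [:1, q ^ i:]) * (\<Prod>i<n. [:q ^ Suc i, 1:])"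
  have "coeff ([:1, q ^ m:] * ?P) k =
      qbinomial q (Suc (m + n)) k * q ^ triangular (int k - int n)"
  proof (cases k)
    case 0
    show ?thesis unfolding 0 coeff_linear_mult_0 Suc.IH by simp
  next
    case k: (Suc l)
    show ?thesis
    proof (cases "l \<le> m + n")
      case True
      have "int (m + n - l) = int m + int n - int l" using True by simp
      then have "m + triangular (int l - int n) = m + n - l + triangular (int l + 1 - int n)"
        using triangular_step [of "int l - int n"] by (simp add: algebra_simps)
      then have "q ^ m * q ^ triangular (int l - int n) =
          q ^ (m + n - l) * q ^ triangular (int l + 1 - int n)"
        by (metis power_add)
      then have "q ^ m * (qbinomial q (m + n) l * q ^ triangular (int l - int n)) =
          q ^ (m + n - l) * qbinomial q (m + n) l * q ^ triangular (int l + 1 - int n)"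
        by (simp only: mult.assoc mult.left_commute [of _ "qbinomial q (m + n) l"])
      then show ?thesis
        unfolding k coeff_linear_mult_Suc Suc.IH qbinomial_Suc_Suc' [OF True]
        by (simp add: algebra_simps)
    next
      case False
      then show ?thesis
        unfolding k coeff_linear_mult_Suc Suc.IH by (simp add: qbinomial_eq_0)
    qed
  qed
  then show ?case by (simp only: prod.lessThan_Suc add_Suc mult_ac)
qed

section \<open>The triple product and its special cases\<close>

abbreviation euler_product :: "nat \<Rightarrow> int fps" where
  "euler_product s \<equiv> qprod (range (\<lambda>i. s * Suc i))"

lemma qpochhammer_fps_X_power:
  assumes "0 < s"
  shows "fps_X ^ (s * Suc n) dvd euler_product s - qpochhammer (fps_X ^ s) n"
proof -
  have "strict_mono (\<lambda>i. s * Suc i)" using assms by (auto simp: strict_mono_def)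
  from qprod_range_truncate [OF this, of n] show ?thesis
    using assms by (simp only: qpochhammer_def power_mult [symmetric])
qed

lemma qprod_mult_cancel_dvd:
  assumes "0 \<notin> S" "d dvd qprod S * f"
  shows "d dvd f"
proof -
  have "f = partition_series S * (qprod S * f)"
    using partition_series_mult_qprod [OF assms(1)] by (simp flip: mult.assoc)
  then show ?thesis using assms(2) by (metis dvd_mult)
qed

text \<open>
  From \<open>[n choose k] (q)_k (q)_(n-k) = (q)_n\<close> and the fact that each of the three finite products
  agrees with the infinite one to high order, the Gaussian binomial coefficient agrees with the
  inverse of the infinite product.
\<close>
lemma qbinomial_limit:
  fixes s n k :: nat
  defines "E \<equiv> euler_product s"
  assumes "0 < s" "k \<le> n" "r \<le> s * Suc k" "r \<le> s * Suc (n - k)"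
  shows "fps_X ^ r dvd E * qbinomial (fps_X ^ s) n k - 1"
proof -
  have trunc: "fps_X ^ r dvd E - qpochhammer (fps_X ^ s) m" if "r \<le> s * Suc m" for m
    using qpochhammer_fps_X_power [OF \<open>0 < s\<close>, of m] le_imp_power_dvd [OF that]
    unfolding E_def by (rule dvd_trans [rotated])
  let ?B = "qbinomial (fps_X ^ s) n k :: int fps" and ?P = "qpochhammer (fps_X ^ s) :: nat \<Rightarrow> int fps"
  have "r \<le> s * Suc n" using assms(3,4) order_trans by fastforce
  then have 1: "fps_X ^ r dvd E - ?P n" by (rule trunc)
  have 2: "fps_X ^ r dvd E - ?P k" and 3: "fps_X ^ r dvd E - ?P (n - k)"
    using assms trunc by auto
  have "E * (E * ?B - 1) = ?B * E * (E - ?P k) + ?B * ?P k * (E - ?P (n - k)) - (E - ?P n)"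
    using qbinomial_qpochhammer [OF \<open>k \<le> n\<close>, of "fps_X ^ s :: int fps"] by (simp add: algebra_simps)
  also have "fps_X ^ r dvd \<dots>"
    by (rule dvd_diff [OF dvd_add [OF dvd_mult [OF 2] dvd_mult [OF 3]] 1])
  finally show ?thesis
    unfolding E_def by (rule qprod_mult_cancel_dvd [rotated]) (use \<open>0 < s\<close> in auto)
qed

text \<open>
  The limit of a weighted finite triple product. The weight stays arbitrary because it is applied
  both to the triple product itself and to its derivative in \<open>z\<close>.
\<close>
lemma qbinomial_sum_limit:
  assumes s: "0 < s" "a \<le> s" and "N < n"
  shows "(euler_product s * (\<Sum>k\<le>2 * n. of_int (w (int k - int n)) *
      qbinomial (fps_X ^ s) (2 * n) k * fps_X ^ jacobi_exponent s a (int k - int n))) $ N =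
    formal_sum UNIV w (jacobi_exponent s a) $ N"
proof -
  let ?E = "euler_product s" and ?B = "qbinomial (fps_X ^ s) (2 * n) :: nat \<Rightarrow> int fps"
    and ?e = "\<lambda>k. jacobi_exponent s a (int k - int n)"
  have "fps_X ^ n dvd of_int (w (int k - int n)) * (fps_X ^ ?e k * (?E * ?B k - 1))"
    if k: "k \<le> 2 * n" for k
  proof -
    \<comment> \<open>\<open>r\<close> is \<open>n + 1\<close> minus the distance of \<open>k\<close> from the centre \<open>n\<close>; the exponent makes up for that distance.\<close>
    define r where "r = Suc (min k (2 * n - k))"
    have "r \<le> s * Suc k" "r \<le> s * Suc (2 * n - k)"
      using s mult_le_mono1 [of 1 s "Suc k"] mult_le_mono1 [of 1 s "Suc (2 * n - k)"]
      by (auto simp: r_def)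
    then have "fps_X ^ r dvd ?E * ?B k - 1"
      using s k by (intro qbinomial_limit) auto
    then have "fps_X ^ (?e k + r) dvd fps_X ^ ?e k * (?E * ?B k - 1)"
      by (simp add: power_add mult_dvd_mono)
    moreover have "n \<le> ?e k + r"
      using abs_le_jacobi_exponent [OF s(2,1), of "int k - int n"] k by (auto simp: r_def min_def)
    ultimately show ?thesis
      by (meson dvd_mult dvd_trans le_imp_power_dvd)
  qed
  then have "fps_X ^ n dvd (\<Sum>k\<le>2 * n. of_int (w (int k - int n)) * (fps_X ^ ?e k * (?E * ?B k - 1)))"
    by (intro dvd_sum) auto
  also have "\<dots> = ?E * (\<Sum>k\<le>2 * n. of_int (w (int k - int n)) * ?B k * fps_X ^ ?e k)
      - (\<Sum>k\<le>2 * n. of_int (w (int k - int n)) * fps_X ^ ?e k)"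
    by (simp add: sum_distrib_left algebra_simps sum_subtractf)
  finally have "(?E * (\<Sum>k\<le>2 * n. of_int (w (int k - int n)) * ?B k * fps_X ^ ?e k)) $ N
      = (\<Sum>k\<le>2 * n. of_int (w (int k - int n)) * fps_X ^ ?e k) $ N"
    using \<open>N < n\<close> by (simp add: fps_X_power_dvd_iff)
  also have "\<dots> = (\<Sum>k\<le>2 * n. if ?e k = N then w (int k - int n) else 0)"
    by (auto simp: fps_sum_nth intro!: sum.cong)
  also have "\<dots> = (\<Sum>k | k \<le> 2 * n \<and> ?e k = N. w (int k - int n))"
    by (simp add: sum.If_cases Int_def)
  also have "\<dots> = (\<Sum>j | j \<in> UNIV \<and> jacobi_exponent s a j = N. w j)"
  proof (rule sum.reindex_bij_witness [where i = "\<lambda>j. nat (j + int n)" and j = "\<lambda>k. int k - int n"])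
    fix j assume j: "j \<in> {j. j \<in> UNIV \<and> jacobi_exponent s a j = N}"
    then have "\<bar>j\<bar> \<le> int n"
      using abs_le_jacobi_exponent [OF s(2,1), of j] \<open>N < n\<close> by auto
    then show "int (nat (j + int n)) - int n = j" "nat (j + int n) \<in> {k. k \<le> 2 * n \<and> ?e k = N}"
      using j by auto
  qed auto
  finally show ?thesis by (simp add: formal_sum_nth)
qed

lemma poly_eq_sum_coeff:
  fixes p :: "'a::comm_ring_1 poly"
  assumes "\<And>k. n < k \<Longrightarrow> coeff p k = 0"
  shows "poly p x = (\<Sum>k\<le>n. coeff p k * x ^ k)"
proof -
  have "degree p \<le> n" using assms by (meson degree_le)
  then show ?thesis
    unfolding poly_altdef
    by (intro sum.mono_neutral_left) (auto simp: coeff_eq_0)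
qed

lemma poly_pderiv_eq_sum_coeff:
  fixes p :: "'a::idom poly"
  assumes "\<And>k. n < k \<Longrightarrow> coeff p k = 0"
  shows "x * poly (pderiv p) x = (\<Sum>k\<le>n. of_nat k * coeff p k * x ^ k)"
proof -
  have "x * poly (pderiv p) x = poly ([:0, 1:] * pderiv p) x" by simp
  also have "\<dots> = (\<Sum>k\<le>n. coeff ([:0, 1:] * pderiv p) k * x ^ k)"
    by (rule poly_eq_sum_coeff) (use assms in \<open>auto simp: coeff_pCons coeff_pderiv split: nat.split\<close>)
  also have "\<dots> = (\<Sum>k\<le>n. of_nat k * coeff p k * x ^ k)"
    by (rule sum.cong) (auto simp: coeff_pCons coeff_pderiv split: nat.split)
  finally show ?thesis .
qed

abbreviation parity_sign :: "int \<Rightarrow> int" where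
  "parity_sign j \<equiv> (if even j then 1 else - 1)"

lemma minus_one_power_eq_parity_sign:
  "(- 1 :: int fps) ^ k = (- 1) ^ n * of_int (parity_sign (int k - int n))"
  by (cases "even k"; cases "even n") auto

text \<open>
  The finite triple product at \<open>z = - X^a\<close>, followed by the limit.
\<close>
lemma jacobi_triple_product:
  assumes a: "0 < a" "a < s"
  shows "qprod (range (\<lambda>i. s * i + a)) * qprod (range (\<lambda>i. s * Suc i - a)) * euler_product s =
    formal_sum UNIV parity_sign (jacobi_exponent s a)"
proof (rule fps_ext)
  fix N
  define n where "n = Suc N"
  have s: "0 < s" "a \<le> s" using a by auto
  let ?q = "fps_X ^ s :: int fps" and ?e = "\<lambda>k. jacobi_exponent s a (int k - int n)"
  let ?B = "qbinomial ?q (2 * n)"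
  define F where "F = (\<Prod>i<n. [:1, ?q ^ i:]) * (\<Prod>i<n. [:?q ^ Suc i, 1:])"
  define A where "A = (\<Prod>i<n. 1 - fps_X ^ (s * i + a) :: int fps)"
  define A' where "A' = (\<Prod>i<n. 1 - fps_X ^ (s * Suc i - a) :: int fps)"
  have coeff: "coeff F k = ?B k * ?q ^ triangular (int k - int n)" for k
    unfolding F_def finite_jacobi_triple_product by (simp add: mult_2)
  have "poly F (- (fps_X ^ a)) = A * (\<Prod>i<n. - (fps_X ^ a) * (1 - fps_X ^ (s * Suc i - a)))"
  proof -
    have "fps_X ^ s * fps_X ^ (s * i) = fps_X ^ a * (fps_X ^ (s + s * i - a) :: int fps)" for i
      using s by (simp flip: power_add)
    then show ?thesis
      unfolding F_def A_def poly_mult poly_prod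
      by (intro arg_cong2 [where f = "(*)"] prod.cong refl)
        (simp_all add: power_add power_mult [symmetric] algebra_simps)
  qed
  also have "\<dots> = (- (fps_X ^ a)) ^ n * (A * A')"
    by (simp only: A'_def prod.distrib prod_constant card_lessThan mult_ac)
  also have "poly F (- (fps_X ^ a)) = (\<Sum>k\<le>2 * n. coeff F k * (- (fps_X ^ a)) ^ k)"
    by (rule poly_eq_sum_coeff) (simp add: coeff qbinomial_eq_0)
  also have "\<dots> = (\<Sum>k\<le>2 * n. (- (fps_X ^ a)) ^ n *
      (of_int (parity_sign (int k - int n)) * ?B k * fps_X ^ ?e k))"
  proof (rule sum.cong [OF refl])
    fix k
    \<comment> \<open>The factor \<open>X ^ (a * n)\<close> is common to all terms and is cancelled below.\<close>
    have "s * triangular (int k - int n) + a * k = a * n + ?e k"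
      using s by (simp add: int_jacobi_exponent algebra_simps flip: of_nat_eq_iff [where 'a = int])
    then have "?q ^ triangular (int k - int n) * (fps_X ^ a) ^ k = (fps_X ^ a) ^ n * fps_X ^ ?e k"
      by (simp flip: power_mult power_add)
    then have "(- 1) ^ n * of_int (parity_sign (int k - int n)) * ?B k *
        (?q ^ triangular (int k - int n) * (fps_X ^ a) ^ k) =
        (- 1) ^ n * of_int (parity_sign (int k - int n)) * ?B k * ((fps_X ^ a) ^ n * fps_X ^ ?e k)"
      by (rule arg_cong)
    then show "coeff F k * (- (fps_X ^ a)) ^ k =
        (- (fps_X ^ a)) ^ n * (of_int (parity_sign (int k - int n)) * ?B k * fps_X ^ ?e k)"
      unfolding coeff power_minus [of "fps_X ^ a"] minus_one_power_eq_parity_sign [of k n]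
      by (simp only: mult_ac)
  qed
  finally have "(- (fps_X ^ a)) ^ n * (A * A') = (- (fps_X ^ a)) ^ n *
      (\<Sum>k\<le>2 * n. of_int (parity_sign (int k - int n)) * ?B k * fps_X ^ ?e k)"
    by (simp add: sum_distrib_left)
  then have AA': "A * A' = (\<Sum>k\<le>2 * n. of_int (parity_sign (int k - int n)) * ?B k * fps_X ^ ?e k)"
    by simp
  let ?Q = "qprod (range (\<lambda>i. s * i + a))" and ?Q' = "qprod (range (\<lambda>i. s * Suc i - a))"
  have "fps_X ^ (s * n + a) dvd ?Q - A" unfolding A_def
    by (rule qprod_range_truncate) (use a in \<open>auto simp: strict_mono_def\<close>)
  then have 1: "fps_X ^ n dvd ?Q - A"
    by (rule dvd_trans [rotated]) (use s in \<open>auto intro!: le_imp_power_dvd trans_le_add1\<close>)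
  have "fps_X ^ (s * Suc n - a) dvd ?Q' - A'" unfolding A'_def
  proof (rule qprod_range_truncate)
    show "strict_mono (\<lambda>i. s * Suc i - a)"
      unfolding strict_mono_Suc_iff using a by auto
  qed (use a in auto)
  then have 2: "fps_X ^ n dvd ?Q' - A'"
  proof (rule dvd_trans [rotated])
    have "s * n \<le> s * Suc n - a" using a by simp
    moreover have "n \<le> s * n" using s by simp
    ultimately show "fps_X ^ n dvd (fps_X ^ (s * Suc n - a) :: int fps)"
      using le_imp_power_dvd order_trans by blast
  qed
  have "?Q * ?Q' * euler_product s - euler_product s * (A * A') =
      euler_product s * ((?Q - A) * ?Q' + A * (?Q' - A'))"
    by (simp add: algebra_simps)
  then have "fps_X ^ n dvd ?Q * ?Q' * euler_product s - euler_product s * (A * A')"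
    using 1 2 by simp
  then have "(?Q * ?Q' * euler_product s - euler_product s * (A * A')) $ N = 0"
    unfolding fps_X_power_dvd_iff by (simp only: n_def lessI)
  then have "(?Q * ?Q' * euler_product s) $ N = (euler_product s * (A * A')) $ N"
    by (simp only: fps_sub_nth right_minus_eq)
  then show "(?Q * ?Q' * euler_product s) $ N =
      formal_sum UNIV parity_sign (jacobi_exponent s a) $ N"
    unfolding AA' using qbinomial_sum_limit [OF s, of N n parity_sign] by (simp add: n_def)
qed

text \<open>
  At \<open>z = -1\<close> the finite triple product has a simple zero, and its derivative there is, up to
  sign, a product of two finite products with limit \<open>E^2\<close>; the limit lemma supplies the third factor. As the
  undifferentiated sum vanishes, the weight \<open>j\<close> of the derivative may be replaced by \<open>2j - 1\<close>
  after doubling, which is the form that is symmetric under \<open>j \<mapsto> 1 - j\<close>.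
\<close>
lemma jacobi_cube:
  assumes s: "0 < s"
  shows "2 * euler_product s ^ 3 =
    formal_sum UNIV (\<lambda>j. - parity_sign j * (2 * j - 1)) (jacobi_exponent s 0)"
proof (rule fps_ext)
  fix N
  define n where "n = Suc N"
  let ?q = "fps_X ^ s :: int fps" and ?e = "\<lambda>k. jacobi_exponent s 0 (int k - int n)"
  let ?B = "qbinomial ?q (2 * n)" and ?E = "euler_product s" and ?P = "qpochhammer ?q"
  define R where "R = (\<Prod>i<N. [:1, ?q ^ Suc i:]) * (\<Prod>i<n. [:?q ^ Suc i, 1:])"
  define F where "F = [:1, 1:] * R"
  have F: "F = (\<Prod>i<n. [:1, ?q ^ i:]) * (\<Prod>i<n. [:?q ^ Suc i, 1:])"
    unfolding F_def R_def n_def by (simp add: prod.lessThan_Suc_shift mult_ac del: prod.lessThan_Suc mult_pCons_left)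
  have coeff: "coeff F k = ?B k * fps_X ^ ?e k" for k
    unfolding F finite_jacobi_triple_product
    by (simp add: mult_2 jacobi_exponent_def nat_mult_distrib flip: power_mult)
  have zero: "k > 2 * n \<Longrightarrow> coeff F k = 0" for k
    by (simp add: coeff qbinomial_eq_0)
  have R: "poly R (- 1) = (- 1) ^ n * (?P N * ?P n)"
  proof -
    have "(\<Prod>i<n. ?q ^ Suc i + - 1) = (\<Prod>i<n. - 1 * (1 - ?q ^ Suc i))"
      by (rule prod.cong) auto
    also have "\<dots> = (- 1) ^ n * ?P n"
      by (simp only: prod.distrib qpochhammer_def prod_constant card_lessThan)
    finally show ?thesis
      unfolding R_def qpochhammer_def by (simp add: poly_prod mult_ac)
  qed
  have "0 = poly F (- 1)" by (simp add: F_def)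
  also have "\<dots> = (\<Sum>k\<le>2 * n. coeff F k * (- 1) ^ k)"
    by (rule poly_eq_sum_coeff) (rule zero)
  finally have F0: "(\<Sum>k\<le>2 * n. coeff F k * (- 1) ^ k) = 0" ..
  have "pderiv F = R + [:1, 1:] * pderiv R"
    unfolding F_def pderiv_mult by (simp add: pderiv_pCons)
  then have "- poly R (- 1) = - 1 * poly (pderiv F) (- 1)" by simp
  also have "\<dots> = (\<Sum>k\<le>2 * n. of_nat k * coeff F k * (- 1) ^ k)"
    by (rule poly_pderiv_eq_sum_coeff) (rule zero)
  finally have F1: "(\<Sum>k\<le>2 * n. of_nat k * coeff F k * (- 1) ^ k) = - ((- 1) ^ n * (?P N * ?P n))"
    by (simp add: R)
  have "(- 1) ^ n * (\<Sum>k\<le>2 * n. of_int (- parity_sign (int k - int n) * (2 * (int k - int n) - 1)) *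
      ?B k * fps_X ^ ?e k) =
      (\<Sum>k\<le>2 * n. (2 * of_nat n + 1) * (coeff F k * (- 1) ^ k) - 2 * (of_nat k * coeff F k * (- 1) ^ k))"
    unfolding sum_distrib_left
  proof (rule sum.cong [OF refl])
    fix k
    show "(- 1) ^ n * (of_int (- parity_sign (int k - int n) * (2 * (int k - int n) - 1)) *
      ?B k * fps_X ^ ?e k) = (2 * of_nat n + 1) * (coeff F k * (- 1) ^ k) - 2 * (of_nat k * coeff F k * (- 1) ^ k)"
      unfolding coeff minus_one_power_eq_parity_sign [of k n] by (simp add: algebra_simps)
  qed
  also have "\<dots> = (- 1) ^ n * (2 * (?P N * ?P n))"
    by (simp add: sum_subtractf F0 F1 flip: sum_distrib_left)
  finally have PP: "2 * (?P N * ?P n) = (\<Sum>k\<le>2 * n.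
      of_int (- parity_sign (int k - int n) * (2 * (int k - int n) - 1)) * ?B k * fps_X ^ ?e k)"
    by simp
  have trunc: "fps_X ^ n dvd ?E - ?P m" if "m \<ge> N" for m
  proof -
    have "n \<le> s * Suc m" using s that mult_le_mono [of 1 s n "Suc m"] by (simp add: n_def)
    then show ?thesis
      using qpochhammer_fps_X_power [OF s, of m] le_imp_power_dvd dvd_trans by blast
  qed
  have "2 * ?E ^ 3 - ?E * (2 * (?P N * ?P n)) = 2 * ?E * ((?E - ?P N) * ?E + ?P N * (?E - ?P n))"
    by (simp add: algebra_simps power3_eq_cube)
  moreover have "fps_X ^ n dvd ?E - ?P N" "fps_X ^ n dvd ?E - ?P n"
    by (rule trunc, simp add: n_def)+
  ultimately have "fps_X ^ n dvd 2 * ?E ^ 3 - ?E * (2 * (?P N * ?P n))"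
    by simp
  then have "(2 * ?E ^ 3 - ?E * (2 * (?P N * ?P n))) $ N = 0"
    unfolding fps_X_power_dvd_iff by (simp only: n_def lessI)
  then have "(2 * ?E ^ 3) $ N = (?E * (2 * (?P N * ?P n))) $ N"
    by (simp only: fps_sub_nth right_minus_eq)
  also have "\<dots> = formal_sum UNIV (\<lambda>j. - parity_sign j * (2 * j - 1)) (jacobi_exponent s 0) $ N"
    unfolding PP by (rule qbinomial_sum_limit) (use s in \<open>auto simp: n_def\<close>)
  finally show "(2 * ?E ^ 3) $ N = \<dots>" .
qed

text \<open>
  The triple product with base \<open>X^(3s)\<close> at \<open>- X^s\<close>: its three factors collect the multiples of \<open>s\<close>
  according to their residue modulo 3 after division by \<open>s\<close>.
\<close>
lemma euler_pentagonal:
  assumes s: "0 < s"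
  shows "euler_product s = formal_sum UNIV parity_sign (jacobi_exponent (3 * s) s)"
proof -
  let ?A = "range (\<lambda>i. 3 * s * i + s)" and ?B = "range (\<lambda>i. 3 * s * Suc i - s)"
    and ?C = "range (\<lambda>i. 3 * s * Suc i)"
  have A: "?A = (*) s ` {t. t mod 3 = 1}"
  proof -
    have "{t. t mod 3 = 1} = range (\<lambda>i. 3 * i + 1 :: nat)"
      by (auto simp: image_iff; presburger)
    then show ?thesis by (simp add: image_image algebra_simps)
  qed
  have B: "?B = (*) s ` {t. t mod 3 = 2}"
  proof -
    have "{t. t mod 3 = 2} = range (\<lambda>i. 3 * i + 2 :: nat)"
      by (auto simp: image_iff; presburger)
    then show ?thesis by (simp add: image_image algebra_simps)
  qed
  have C: "?C = (*) s ` {t. t mod 3 = 0 \<and> t > 0}"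
  proof -
    have "{t. t mod 3 = 0 \<and> t > 0} = range (\<lambda>i. 3 * i + 3 :: nat)"
      by (auto simp: image_iff; presburger)
    then show ?thesis by (simp add: image_image algebra_simps)
  qed
  have "?A \<union> ?B \<union> ?C = (*) s ` ({t. t mod 3 = 1} \<union> {t. t mod 3 = 2} \<union> {t. t mod 3 = 0 \<and> t > 0})"
    by (simp only: A B C image_Un)
  also have "{t. t mod 3 = 1} \<union> {t. t mod 3 = 2} \<union> {t. t mod 3 = 0 \<and> t > 0} = range Suc"
    by (auto simp: image_iff gr0_conv_Suc; presburger)
  also have "(*) s ` range Suc = range (\<lambda>i. s * Suc i)"
    by (simp add: image_image)
  finally have eq: "range (\<lambda>i. s * Suc i) = ?A \<union> ?B \<union> ?C" ..
  have inj: "inj ((*) s)" using s by (auto simp: inj_def)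
  have "euler_product s = qprod (?A \<union> ?B) * qprod ?C"
    unfolding eq
  proof (rule qprod_Un)
    show "(?A \<union> ?B) \<inter> ?C = {}"
      unfolding A B C image_Un [symmetric] image_Int [OF inj, symmetric] by auto
  qed (use s in auto)
  also have "qprod (?A \<union> ?B) = qprod ?A * qprod ?B"
  proof (rule qprod_Un)
    show "?A \<inter> ?B = {}"
      unfolding A B image_Int [OF inj, symmetric] by auto
  qed (use s in auto)
  finally show ?thesis
    using jacobi_triple_product [of s "3 * s"] s by simp
qed

lemma range_double_Suc: "range (\<lambda>i. 2 * Suc i) = {t. even t \<and> 0 < t}"
proof (intro equalityI subsetI)
  fix t :: nat assume "t \<in> {t. even t \<and> 0 < t}"
  then have "t = 2 * Suc (t div 2 - 1)" by auto
  then show "t \<in> range (\<lambda>i. 2 * Suc i)" by (rule range_eqI)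
qed auto

lemma qprod_odd_mult: "qprod {t. odd t} * euler_product 2 = euler_product 1"
proof -
  have "range (\<lambda>i. 1 * Suc i) = {t. odd t} \<union> {t. even t \<and> 0 < t}"
    by (auto simp: image_iff gr0_conv_Suc dest: odd_pos)
  moreover have "qprod ({t. odd t} \<union> {t. even t \<and> 0 < t}) =
      qprod {t. odd t} * qprod {t. even t \<and> 0 < t}"
    by (rule qprod_Un) auto
  ultimately show ?thesis
    by (simp only: range_double_Suc)
qed

text \<open>
  Gauss's theta series with exponents \<open>i^2\<close>: the triple product with base \<open>X^2\<close> at \<open>- X\<close> consists
  of two copies of the product over odd numbers and one over even numbers.
\<close>
lemma gauss_square:
  "euler_product 1 ^ 2 = euler_product 2 * formal_sum UNIV parity_sign (jacobi_exponent 2 1)"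
proof -
  have odds: "range (\<lambda>i. 2 * i + 1) = {t::nat. odd t}" by (auto elim: oddE)
  moreover have "(\<lambda>i. 2 * Suc i - 1) = (\<lambda>i. 2 * i + 1)" by auto
  ultimately have "qprod {t. odd t} * qprod {t. odd t} * euler_product 2 =
      formal_sum UNIV parity_sign (jacobi_exponent 2 1)"
    using jacobi_triple_product [of 1 2] by (simp only: zero_less_one one_less_numeral_iff semiring_norm)
  moreover have "euler_product 1 ^ 2 =
      euler_product 2 * (qprod {t. odd t} * qprod {t. odd t} * euler_product 2)"
    unfolding qprod_odd_mult [symmetric] power2_eq_square by (simp only: mult_ac)
  ultimately show ?thesis by (simp only:)
qed

lemma jacobi_exponent_1_0: "2 * int (jacobi_exponent 1 0 j) = j * (j - 1)"
  and jacobi_exponent_2_0: "int (jacobi_exponent 2 0 j) = j * (j - 1)"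
  and jacobi_exponent_2_1: "int (jacobi_exponent 2 1 j) = j * j"
  and jacobi_exponent_3_1: "2 * int (jacobi_exponent 3 1 j) = j * (3 * j - 1)"
  and jacobi_exponent_6_2: "int (jacobi_exponent 6 2 j) = j * (3 * j - 1)"
proof -
  define t where "t = j * (j - 1) div 2"
  have t: "2 * t = j * (j - 1)"
    by (simp add: t_def even_mult_iff)
  have e: "int (jacobi_exponent s a j) = int s * t + int a * j" if "a \<le> s" for s a
    using that by (simp add: int_jacobi_exponent t_def)
  show "2 * int (jacobi_exponent 1 0 j) = j * (j - 1)"
    "int (jacobi_exponent 2 0 j) = j * (j - 1)"
    using t by (simp_all add: e)
  show "int (jacobi_exponent 2 1 j) = j * j"
    "2 * int (jacobi_exponent 3 1 j) = j * (3 * j - 1)"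
    "int (jacobi_exponent 6 2 j) = j * (3 * j - 1)"
    by (simp_all add: e, (use t in algebra)+)
qed

section \<open>The quintuple product in derivative form\<close>

definition quintuple_theta :: "int fps" where
  "quintuple_theta = formal_sum UNIV (\<lambda>m. 1 - 6 * m) (jacobi_exponent 3 1)"

lemma alternating_triangular_sum_zero: "formal_sum UNIV parity_sign triangular = 0"
proof (rule formal_sum_sign_reversing_involution [where h = "\<lambda>j. 1 - j"])
  fix j :: int
  have "2 * int (triangular (1 - j)) = 2 * int (triangular j)"
    unfolding jacobi_exponent_1_0 by (simp add: algebra_simps)
  then show "triangular (1 - j) = triangular j" by simp
qed auto

text \<open>
  With \<open>x = 6m - 1\<close>, \<open>y = 6n - 1\<close> and \<open>Y = 2j - 1\<close>, the norm forms in \<open>x^2 + 2 y^2 = 3 (Y^2 + 8 i^2)\<close>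
  are related by multiplication with \<open>1 + \<surd>-2\<close>, an element of norm 3:
  \<open>x = Y - 4 i\<close> and \<open>y = Y + 2 i = 2 (i + j) - 1\<close>. The residue of \<open>i + j\<close> modulo 3 determines \<open>y\<close>
  modulo 6; in class 0 this is the map below, and in class 1 it is the same map up to the sign of
  \<open>(x, y)\<close>.
\<close>
lemma bij_betw_lattice_class_0:
  "bij_betw (\<lambda>(m, n). (2 * n + m, n - m)) (UNIV \<times> UNIV) {(j, i). (i + j) mod 3 = (0 :: int)}"
  by (rule bij_betw_byWitness [where f' = "\<lambda>(j, i). ((i + j) div 3 - i, (i + j) div 3)"])
    (auto simp: algebra_simps elim!: dvdE simp flip: dvd_eq_mod_eq_0)

lemma bij_betw_lattice_class_1:
  "bij_betw (\<lambda>(m, n). (1 - 2 * n - m, m - n)) (UNIV \<times> UNIV) {(j, i). (i + j) mod 3 = (1 :: int)}"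
  by (rule bij_betw_byWitness
      [where f' = "\<lambda>(j, i). (i + (1 - (i + j)) div 3, (1 - (i + j)) div 3)"])
    (auto; presburger)+

text \<open>
  Both sides are double theta series whose exponents correspond under the substitution above. On
  the right, the weight \<open>Y\<close> may be replaced by \<open>Y - 4 i = x\<close>, since the alternating sum over
  \<open>j\<close> alone is zero. The classes 0 and 1 of \<open>i + j\<close> modulo 3 then each give a copy of the left
  product, and in class 2 the reflection \<open>x \<mapsto> - x\<close> with \<open>y\<close> fixed reverses the sign of the weight.
\<close>
lemma quintuple_theta_mult:
  "2 * (quintuple_theta * euler_product 2) =
    2 * euler_product 1 ^ 3 * formal_sum UNIV parity_sign (jacobi_exponent 2 1)"
proof -
  let ?a = "\<lambda>(j, i). parity_sign j * parity_sign i * (1 - 2 * j + 4 * i)"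
  let ?e = "\<lambda>(j, i). triangular j + jacobi_exponent 2 1 i"
  let ?b = "\<lambda>(m, n). (1 - 6 * m) * parity_sign n"
  let ?f = "\<lambda>(m, n). jacobi_exponent 3 1 m + jacobi_exponent 6 2 n"
  let ?I = "\<lambda>r. {(j, i). (i + j) mod 3 = (r :: int)}"
  note fin = finite_fibres_jacobi_exponent
  have fin': "finite_fibres A ?e" for A
    by (rule finite_fibres_subset [OF finite_fibres_Times [OF fin fin]]) auto
  have WE: "quintuple_theta * euler_product 2 = formal_sum (UNIV \<times> UNIV) ?b ?f"
    unfolding quintuple_theta_def euler_pentagonal [OF zero_less_numeral]
    by (simp add: formal_sum_mult fin)
  have exponent: "?e (j, i) = ?f (m, n)"
    if "j * (j - 1) + 2 * (i * i) = m * (3 * m - 1) + 2 * (n * (3 * n - 1))" for j i m n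
  proof -
    have "2 * int (?e (j, i)) = 2 * int (?f (m, n))"
      using that by (simp only: prod.case of_nat_add distrib_left jacobi_exponent_1_0
          jacobi_exponent_2_1 jacobi_exponent_3_1 jacobi_exponent_6_2)
    then show ?thesis by simp
  qed
  have "formal_sum (UNIV \<times> UNIV) ?b ?f = formal_sum (?I 0) ?a ?e"
  proof (rule formal_sum_bij_betw [OF bij_betw_lattice_class_0])
    fix p :: "int \<times> int"
    obtain m n where p: "p = (m, n)" by fastforce
    show "?b p = ?a (case p of (m, n) \<Rightarrow> (2 * n + m, n - m))"
      by (auto simp: p)
    show "?f p = ?e (case p of (m, n) \<Rightarrow> (2 * n + m, n - m))"
      using exponent [of "2 * n + m" "n - m" m n] by (simp add: p algebra_simps)
  qed
  moreover have "formal_sum (UNIV \<times> UNIV) ?b ?f = formal_sum (?I 1) ?a ?e"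
  proof (rule formal_sum_bij_betw [OF bij_betw_lattice_class_1])
    fix p :: "int \<times> int"
    obtain m n where p: "p = (m, n)" by fastforce
    show "?b p = ?a (case p of (m, n) \<Rightarrow> (1 - 2 * n - m, m - n))"
      by (auto simp: p)
    show "?f p = ?e (case p of (m, n) \<Rightarrow> (1 - 2 * n - m, m - n))"
      using exponent [of "1 - 2 * n - m" "m - n" m n] by (simp add: p algebra_simps)
  qed
  moreover have "formal_sum (?I 2) ?a ?e = 0"
  proof (rule formal_sum_sign_reversing_involution)
    let ?n = "\<lambda>j i. (i + j - 2) div 3 :: int"
    let ?h = "\<lambda>(j, i). (?n j i + 1 + i, 2 * ?n j i + 1 - i)"
    fix p assume "p \<in> ?I 2"
    then obtain j i where p: "p = (j, i)" and mod: "(i + j) mod 3 = 2" by auto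
    define n where "n = ?n j i"
    have j: "j = 3 * n + 2 - i" using mod unfolding n_def by presburger
    have h: "?h p = (n + 1 + i, 2 * n + 1 - i)" by (simp add: p n_def)
    have n': "?n (n + 1 + i) (2 * n + 1 - i) = n" by simp
    show "?h p \<in> ?I 2" unfolding h by simp
    show "?h (?h p) = p" unfolding h prod.case n' by (simp add: p j)
    show "?a (?h p) = - ?a p" unfolding h by (auto simp: p j)
    have "2 * int (?e (?h p)) = 2 * int (?e p)"
      unfolding h p by (simp only: prod.case of_nat_add distrib_left jacobi_exponent_1_0 jacobi_exponent_2_1)
        (simp add: j algebra_simps)
    then show "?e (?h p) = ?e p" by simp
  qed
  ultimately have classes: "formal_sum (?I 0) ?a ?e = formal_sum (UNIV \<times> UNIV) ?b ?f"
    "formal_sum (?I 1) ?a ?e = formal_sum (UNIV \<times> UNIV) ?b ?f" "formal_sum (?I 2) ?a ?e = 0"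
    by simp_all
  have "2 * euler_product 1 ^ 3 * formal_sum UNIV parity_sign (jacobi_exponent 2 1) =
      formal_sum UNIV (\<lambda>j. - parity_sign j * (2 * j - 1)) triangular *
        formal_sum UNIV parity_sign (jacobi_exponent 2 1)
      + formal_sum UNIV parity_sign triangular *
        formal_sum UNIV (\<lambda>i. 4 * i * parity_sign i) (jacobi_exponent 2 1)"
    by (simp only: jacobi_cube [OF zero_less_one] alternating_triangular_sum_zero) simp
  also have "\<dots> = formal_sum (UNIV \<times> UNIV) ?a ?e"
    by (simp add: formal_sum_mult fin flip: formal_sum_add) (simp add: case_prod_unfold algebra_simps)
  also have "UNIV \<times> UNIV = ?I 0 \<union> (?I 1 \<union> ?I 2)"
    by auto
  also have "formal_sum \<dots> ?a ?e = formal_sum (?I 0) ?a ?e + formal_sum (?I 1 \<union> ?I 2) ?a ?e"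
    by (rule formal_sum_Un [OF fin' fin']) auto
  also have "formal_sum (?I 1 \<union> ?I 2) ?a ?e = formal_sum (?I 1) ?a ?e + formal_sum (?I 2) ?a ?e"
    by (rule formal_sum_Un [OF fin' fin']) auto
  finally show ?thesis
    unfolding classes WE by simp
qed

text \<open>
  The factor \<open>E2\<close> combines with Gauss's theta series to \<open>E1^2\<close>.
\<close>
lemma quintuple_theta_eq: "quintuple_theta * euler_product 2 ^ 2 = euler_product 1 ^ 5"
proof -
  have "2 * (quintuple_theta * euler_product 2 ^ 2) =
      2 * (quintuple_theta * euler_product 2) * euler_product 2"
    by (simp add: power2_eq_square mult_ac)
  also have "\<dots> = 2 * euler_product 1 ^ 3 *
      (euler_product 2 * formal_sum UNIV parity_sign (jacobi_exponent 2 1))"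
    unfolding quintuple_theta_mult by (simp only: mult_ac)
  also have "\<dots> = 2 * euler_product 1 ^ 5"
    unfolding gauss_square [symmetric] by (simp flip: power_add)
  finally show ?thesis by simp
qed

section \<open>The two congruences\<close>

text \<open>
  The series of partitions into even parts is the reciprocal of \<open>E2\<close>, and the product over odd
  numbers is \<open>E1 / E2\<close>.
\<close>
lemma SEDO_series_mult:
  "euler_product 2 ^ 3 * SEDO_series = - (euler_product 1 * euler_deriv (euler_product 2))"
proof -
  define A where "A = partition_series {t. even t \<and> 0 < t}"
  define E where "E = euler_product 2"
  define g where "g = qprod {t. odd t}"
  have AE: "A * E = 1"
    unfolding A_def E_def range_double_Suc by (rule partition_series_mult_qprod) simp
  have "A * euler_deriv E + euler_deriv A * E = 0"
    using euler_deriv_mult [of A E] by (simp add: AE euler_deriv_one)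
  then have "E * (A * euler_deriv E + euler_deriv A * E) = 0" by simp
  then have "(A * E) * euler_deriv E + E ^ 2 * euler_deriv A = 0"
    by (simp add: algebra_simps power2_eq_square)
  then have *: "E ^ 2 * euler_deriv A = - euler_deriv E"
    by (simp add: AE eq_neg_iff_add_eq_0 add.commute)
  have gE: "g * E = euler_product 1"
    unfolding g_def E_def by (rule qprod_odd_mult)
  have "E ^ 3 * (g * euler_deriv A) = g * E * (E ^ 2 * euler_deriv A)"
    by (simp add: power2_eq_square power3_eq_cube mult_ac)
  also have "\<dots> = - (euler_product 1 * euler_deriv E)"
    unfolding * gE by simp
  finally show ?thesis
    unfolding SEDO_series_def A_def E_def g_def .
qed

text \<open>
  After completing squares the hypothesis reads \<open>x^2 + y^2 \<equiv> 2\<close> modulo 5 with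
  \<open>x = 6m - 1\<close> and \<open>y = 2j - 1\<close>. The squares are \<open>0, 1, 4\<close>, so this needs \<open>y^2 \<equiv> 1\<close>.
\<close>
lemma five_dvd_pronic:
  fixes m j :: int
  assumes "5 dvd m * (3 * m - 1) + 2 * (j * (j - 1))"
  shows "5 dvd j * (j - 1)"
proof -
  have residues: "x mod 5 \<in> {0, 1, 2, 3, 4}" for x :: int
    by (simp only: insert_iff empty_iff) presburger
  have check: "5 dvd s * (s - 1)"
    if "r \<in> {0, 1, 2, 3, 4}" "s \<in> {0, 1, 2, 3, 4}" "5 dvd r * (3 * r - 1) + 2 * (s * (s - 1))"
    for r s :: int
    using that by auto
  have c: "[m = m mod 5] (mod 5)" "[j = j mod 5] (mod 5)" by (simp_all add: cong_def)
  have "[m * (3 * m - 1) + 2 * (j * (j - 1)) =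
      (m mod 5) * (3 * (m mod 5) - 1) + 2 * ((j mod 5) * ((j mod 5) - 1))] (mod 5)"
    and "[j * (j - 1) = (j mod 5) * ((j mod 5) - 1)] (mod 5)"
    by (intro cong_add cong_mult cong_diff cong_refl c)+
  then show ?thesis
    using assms check [OF residues residues, of m j] by (simp only: cong_dvd_iff)
qed

lemma SEDO_series_5: "5 dvd SEDO_series $ (5 * n)"
proof -
  define E where "E = euler_product 2"
  have "6 * (E ^ 5 * SEDO_series) = - (euler_product 1 * euler_deriv (2 * E ^ 3))"
  proof -
    have "6 * (E ^ 5 * SEDO_series) = 6 * E ^ 2 * (E ^ 3 * SEDO_series)"
      by (simp flip: mult.assoc power_add)
    also have "\<dots> = - (euler_product 1 * (2 * (3 * E ^ 2 * euler_deriv E)))"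
      unfolding SEDO_series_mult [folded E_def] by (simp add: algebra_simps)
    also have "3 * E ^ 2 * euler_deriv E = euler_deriv (E ^ 3)"
      by (simp add: euler_deriv_power)
    also have "2 * euler_deriv (E ^ 3) = euler_deriv (2 * E ^ 3)"
      by (simp only: euler_deriv_double)
    finally show ?thesis .
  qed
  also have "euler_product 1 * euler_deriv (2 * E ^ 3) = formal_sum (UNIV \<times> UNIV)
      (\<lambda>(m, j). parity_sign m * (int (jacobi_exponent 2 0 j) * (- parity_sign j * (2 * j - 1))))
      (\<lambda>(m, j). jacobi_exponent 3 1 m + jacobi_exponent 2 0 j)"
    unfolding E_def jacobi_cube [OF zero_less_numeral] euler_pentagonal [OF zero_less_one] euler_deriv_formal_sum
    by (simp add: formal_sum_mult finite_fibres_jacobi_exponent)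
  finally have eq: "6 * (E ^ 5 * SEDO_series) = - \<dots>" .
  have "5 dvd (E ^ 5 * SEDO_series) $ (5 * k)" for k
  proof -
    have "5 dvd int (jacobi_exponent 2 0 j)"
      if "jacobi_exponent 3 1 m + jacobi_exponent 2 0 j = 5 * k" for m j
    proof -
      have "2 * int (jacobi_exponent 3 1 m) + 2 * int (jacobi_exponent 2 0 j) = 5 * (2 * int k)"
        using that by linarith
      then have "5 dvd m * (3 * m - 1) + 2 * (j * (j - 1))"
        unfolding jacobi_exponent_3_1 jacobi_exponent_2_0 by simp
      then show ?thesis unfolding jacobi_exponent_2_0 by (rule five_dvd_pronic)
    qed
    then have "5 dvd (6 * (E ^ 5 * SEDO_series)) $ (5 * k)"
      unfolding eq fps_neg_nth dvd_minus_iff by (intro dvd_formal_sum_nth) auto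
    then have "5 dvd 6 * (E ^ 5 * SEDO_series) $ (5 * k)"
      by (simp add: numeral_fps_const)
    then show ?thesis by presburger
  qed
  moreover have "E $ 0 = 1"
    unfolding E_def by (rule qprod_nth_0) auto
  ultimately show ?thesis
    using prime_dvd_nth_multiples_cancel [of 5 E SEDO_series n] by simp
qed

text \<open>
  After completing squares the hypothesis reads \<open>5 x^2 + y^2 \<equiv> 6\<close> modulo 7 with \<open>x = 6m - 1\<close> and
  \<open>y = 2j - 1\<close>. The squares are \<open>0, 1, 2, 4\<close>, so either \<open>y \<equiv> 0\<close> or \<open>x^2 \<equiv> y^2 \<equiv> 1\<close>.
\<close>
lemma seven_dvd_cases:
  fixes m j :: int
  assumes "7 dvd m * (3 * m - 1) + j * (j - 1)"
  shows "7 dvd 2 * j - 1 \<or> 7 dvd m * (3 * m - 1) \<and> 7 dvd j * (j - 1)"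
proof -
  have residues: "x mod 7 \<in> {0, 1, 2, 3, 4, 5, 6}" for x :: int
    by (simp only: insert_iff empty_iff) presburger
  have check: "7 dvd 2 * s - 1 \<or> 7 dvd r * (3 * r - 1) \<and> 7 dvd s * (s - 1)"
    if "r \<in> {0, 1, 2, 3, 4, 5, 6}" "s \<in> {0, 1, 2, 3, 4, 5, 6}" "7 dvd r * (3 * r - 1) + s * (s - 1)"
    for r s :: int
    using that by auto
  have c: "[m = m mod 7] (mod 7)" "[j = j mod 7] (mod 7)" by (simp_all add: cong_def)
  have "[m * (3 * m - 1) + j * (j - 1) =
      (m mod 7) * (3 * (m mod 7) - 1) + (j mod 7) * ((j mod 7) - 1)] (mod 7)"
    and "[m * (3 * m - 1) = (m mod 7) * (3 * (m mod 7) - 1)] (mod 7)"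
    and "[j * (j - 1) = (j mod 7) * ((j mod 7) - 1)] (mod 7)"
    and "[2 * j - 1 = 2 * (j mod 7) - 1] (mod 7)"
    by (intro cong_add cong_mult cong_diff cong_refl c)+
  then show ?thesis
    using assms check [OF residues residues, of m j] by (simp only: cong_dvd_iff)
qed

lemma SEDO_series_7: "7 dvd SEDO_series $ (7 * n)"
proof -
  define E where "E = euler_product 1"
  define F where "F = euler_product 2"
  define W where "W = quintuple_theta"
  define U where "U = 2 * E ^ 3"
  have F0: "F \<noteq> 0"
    using qprod_nth_0 [of "{t. even t \<and> 0 < t}"] unfolding F_def range_double_Suc by auto
  have WF: "W * F ^ 2 = E ^ 5"
    unfolding W_def F_def E_def by (rule quintuple_theta_eq)
  have dWF: "euler_deriv W * F ^ 2 = 5 * E ^ 4 * euler_deriv E - 2 * W * F * euler_deriv F"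
    using arg_cong [OF WF, of euler_deriv] by (simp add: euler_deriv_mult euler_deriv_power algebra_simps)
  have dU: "euler_deriv U = 6 * E ^ 2 * euler_deriv E"
    by (simp add: U_def euler_deriv_double euler_deriv_power)
  \<comment> \<open>The coefficients 3 and 5 are chosen so that the terms with \<open>euler_deriv E\<close> cancel.\<close>
  have "F ^ 3 * (12 * (E ^ 7 * SEDO_series)) = F ^ 3 * (3 * (U * euler_deriv W) - 5 * (W * euler_deriv U))"
  proof -
    have "F ^ 3 * (12 * (E ^ 7 * SEDO_series)) = - 12 * E ^ 8 * euler_deriv F"
    proof -
      have "F ^ 3 * (12 * (E ^ 7 * SEDO_series)) = 12 * E ^ 7 * (F ^ 3 * SEDO_series)"
        by (simp only: mult_ac)
      also have "F ^ 3 * SEDO_series = - (E * euler_deriv F)"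
        unfolding F_def E_def by (rule SEDO_series_mult)
      finally show ?thesis by (simp add: algebra_simps eval_nat_numeral)
    qed
    also have "\<dots> = 6 * E ^ 3 * F * (5 * E ^ 4 * euler_deriv E - 2 * W * F * euler_deriv F)
        - 30 * E ^ 2 * F * (W * F ^ 2) * euler_deriv E"
      using WF by algebra
    also have "\<dots> = F ^ 3 * (3 * (U * euler_deriv W) - 5 * (W * euler_deriv U))"
      unfolding dWF [symmetric] dU unfolding U_def by algebra
    finally show ?thesis .
  qed
  then have eq: "12 * (E ^ 7 * SEDO_series) = 3 * (U * euler_deriv W) - 5 * (W * euler_deriv U)"
    using F0 by simp
  have U: "U = formal_sum UNIV (\<lambda>j. - parity_sign j * (2 * j - 1)) (jacobi_exponent 1 0)"
    unfolding U_def E_def by (rule jacobi_cube) simp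
  note fin = finite_fibres_jacobi_exponent
  have UdW: "U * euler_deriv W = formal_sum (UNIV \<times> UNIV)
      (\<lambda>(j, m). - parity_sign j * (2 * j - 1) * (int (jacobi_exponent 3 1 m) * (1 - 6 * m)))
      (\<lambda>(j, m). jacobi_exponent 1 0 j + jacobi_exponent 3 1 m)"
    unfolding U W_def quintuple_theta_def euler_deriv_formal_sum by (rule formal_sum_mult) (simp_all add: fin)
  have WdU: "euler_deriv U * W = formal_sum (UNIV \<times> UNIV)
      (\<lambda>(j, m). int (jacobi_exponent 1 0 j) * (- parity_sign j * (2 * j - 1)) * (1 - 6 * m))
      (\<lambda>(j, m). jacobi_exponent 1 0 j + jacobi_exponent 3 1 m)"
    unfolding U W_def quintuple_theta_def euler_deriv_formal_sum by (rule formal_sum_mult) (simp_all add: fin)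
  have "7 dvd (E ^ 7 * SEDO_series) $ (7 * k)" for k
  proof -
    have cases: "7 dvd 2 * j - 1 \<or> 7 dvd int (jacobi_exponent 3 1 m) \<and> 7 dvd int (jacobi_exponent 1 0 j)"
      if "jacobi_exponent 1 0 j + jacobi_exponent 3 1 m = 7 * k" for j m
    proof -
      have "2 * int (jacobi_exponent 3 1 m) + 2 * int (jacobi_exponent 1 0 j) = 7 * (2 * int k)"
        using that by linarith
      then have "7 dvd m * (3 * m - 1) + j * (j - 1)"
        unfolding jacobi_exponent_3_1 jacobi_exponent_1_0 by simp
      then show ?thesis
        using seven_dvd_cases [of m j] unfolding jacobi_exponent_3_1 [symmetric] jacobi_exponent_1_0 [symmetric]
        by presburger
    qed
    have "7 dvd (U * euler_deriv W) $ (7 * k)"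
      unfolding UdW
    proof (rule dvd_formal_sum_nth, clarify)
      fix j m :: int
      assume "jacobi_exponent 1 0 j + jacobi_exponent 3 1 m = 7 * k"
      then show "7 dvd - parity_sign j * (2 * j - 1) * (int (jacobi_exponent 3 1 m) * (1 - 6 * m))"
        by (elim cases [THEN disjE] conjE) (blast intro: dvd_mult dvd_mult2)+
    qed
    moreover have "7 dvd (W * euler_deriv U) $ (7 * k)"
      unfolding mult.commute [of W] WdU
    proof (rule dvd_formal_sum_nth, clarify)
      fix j m :: int
      assume "jacobi_exponent 1 0 j + jacobi_exponent 3 1 m = 7 * k"
      then show "7 dvd int (jacobi_exponent 1 0 j) * (- parity_sign j * (2 * j - 1)) * (1 - 6 * m)"
        by (elim cases [THEN disjE] conjE) (blast intro: dvd_mult dvd_mult2)+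
    qed
    ultimately have "7 dvd (12 * (E ^ 7 * SEDO_series)) $ (7 * k)"
      unfolding eq by (simp add: numeral_fps_const)
    then have "7 dvd 12 * (E ^ 7 * SEDO_series) $ (7 * k)"
      by (simp add: numeral_fps_const)
    then show ?thesis by presburger
  qed
  moreover have "E $ 0 = 1"
    unfolding E_def by (rule qprod_nth_0) auto
  ultimately show ?thesis
    using prime_dvd_nth_multiples_cancel [of 7 E SEDO_series n] by simp
qed

theorem theorem1p11:
  fixes n :: nat
  shows "[SEDO (5 * n) = 0] (mod 5) \<and> [SEDO (7 * n) = 0] (mod 7)"
proof -
  have "int 5 dvd int (SEDO (5 * n))" "int 7 dvd int (SEDO (7 * n))"
    using SEDO_series_5 [of n] SEDO_series_7 [of n]
    by (simp_all add: SEDO_series_nth minus_one_power_iff split: if_splits)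
  then show ?thesis
    unfolding cong_0_iff int_dvd_int_iff by simp
qed

end
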